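(* Let $\mathbb A$ be an algebra on $\mathbb R^3$ with unit $e$, and let $F:\Omega\to\mathbb R^3$ be an $\mathbb A$-algebrizable vector field defined on an open set $\Omega\subset\mathbb R^3$. Then: (1) The multivalued function $H$ on $\Omega(F,\mathbb A^* )$ given by $$H(w)=\int_\gamma\frac{e}{F}\,d\xi ,$$ where $\gamma$ runs over the differentiable curves in $\Omega(F,\mathbb A^* )$ going from the chosen base point of the connected component of $w$ to $w$, is a multivalued rectification of $F$ on $\Omega(F,\mathbb A^* )$, under which $H_*(F)=e$. (2) There exists a Riemannian metric $g$ on $\Omega(F,\mathbb A^* )$ defined by $$g=\frac{1}{\|e\|^2}H^*\lambda ,$$ where $\|e\|$ is the Euclidean norm of $e$ and $\lambda$ is the natural (Euclidean) Riemannian metric of $\mathbb R^3$.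
   Context: An algebra $\mathbb A$ on $\mathbb R^3$ is the linear space $\mathbb R^3$ endowed with a bilinear, associative, commutative product with unit $e$. $\mathbb A^*$ is the set of elements having a multiplicative inverse; the inverse of $a$ is written $\frac{e}{a}$. A vector field $F:\Omega\subset\mathbb R^3\to\mathbb R^3$, $\Omega$ open, is $\mathbb A$-algebrizable if there is a function $F':\Omega\to\mathbb R^3$ (its $\mathbb A$-derivative) with $\lim_{\xi\to0}|F(w+\xi)-F(w)-F'(w)\xi|/|\xi|=0$ for all $w\in\Omega$, where $F'(w)\xi$ is the product in $\mathbb A$. The regular domain is $\Omega(F,\mathbb A^* )=F^{-1}(\mathbb A^* )$, an open set, on which $\frac{e}{F}$ denotes the function $w\mapsto F(w)^{-1}$ (inverse in $\mathbb A$). For a (piecewise continuously) differentiable curve $\gamma:[0,a]\to\Omega(F,\mathbb A^* )$, $\int_\gamma\frac{e}{F}d\xi:=\int_0^a \frac{e}{F(\gamma(t))}\,\dot\gamma(t)\,dt$, with the product in $\mathbb A$. A base point is fixed in each connected component of $\Omega(F,\mathbb A^* )$; the values of the multivalued function $H$ at $w$ are the values of the integral over all admissible $\gamma$. A multivalued function $H:U\to\mathbb R^3$ is a multivalued rectification of a vector field $F$ on $U$ (with constant $c\in\mathbb R^3$) if for every $w_0\in U$ there is a neighborhood $N(w_0)$ such that for each value $k_\alpha$, $\alpha\in I$, of $H$ at $w_0$ there are a neighborhood $V_\alpha$ of $k_\alpha$ and a local diffeomorphism $H_\alpha:N(w_0)\to V_\alpha$ that is a branch of $H$ with $H_\alpha(w_0)=k_\alpha$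 and with $H_{\alpha*}F=c$ (i.e. $dH_\alpha(w)(F(w))=c$ for $w\in N(w_0)$). "$H_*(F)=e$" means that $c=e$. $\lambda$ is the metric $\lambda_{ij}=\delta_{ij}$ on $\mathbb R^3$. The pullback $H^*\lambda$ is computed with local branches: $(H^*\lambda)_w(u,v)=\langle dH_\alpha(w)u,dH_\alpha(w)v\rangle$ (branches over a point differ by constants, so this does not depend on the branch). Since $F$ is only assumed differentiable, metrics are understood with coefficients of the corresponding (differentiable) regularity. *)

theory Defs
  imports "HOL-Analysis.Analysis"
begin

definition algebra_on_R3 :: "(real^3 \<Rightarrow> real^3 \<Rightarrow> real^3) \<Rightarrow> real^3 \<Rightarrow> bool" where
  "algebra_on_R3 m e \<longleftrightarrow>
     bilinear m \<and>
     (\<forall>a b c. m (m a b) c = m a (m b c)) \<and>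
     (\<forall>a b. m a b = m b a) \<and>
     (\<forall>a. m e a = a)"

definition alg_units :: "(real^3 \<Rightarrow> real^3 \<Rightarrow> real^3) \<Rightarrow> real^3 \<Rightarrow> (real^3) set" where
  "alg_units m e = {a. \<exists>b. m a b = e}"

(* In a commutative monoid the inverse of a unit is unique; off alg_units the value is unspecified. *)
definition alg_inverse :: "(real^3 \<Rightarrow> real^3 \<Rightarrow> real^3) \<Rightarrow> real^3 \<Rightarrow> real^3 \<Rightarrow> real^3" where
  "alg_inverse m e a = (THE b. m a b = e)"

definition algebrizable ::
  "(real^3 \<Rightarrow> real^3 \<Rightarrow> real^3) \<Rightarrow> (real^3 \<Rightarrow> real^3) \<Rightarrow> (real^3) set \<Rightarrow> bool" where
  "algebrizable m F \<Omega> \<longleftrightarrow>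
     (\<exists>F'. \<forall>w\<in>\<Omega>.
        ((\<lambda>\<xi>. norm (F (w + \<xi>) - F w - m (F' w) \<xi>) / norm \<xi>) \<longlongrightarrow> 0) (at 0))"

definition regular_domain ::
  "(real^3 \<Rightarrow> real^3 \<Rightarrow> real^3) \<Rightarrow> real^3 \<Rightarrow> (real^3 \<Rightarrow> real^3) \<Rightarrow> (real^3) set \<Rightarrow> (real^3) set" where
  "regular_domain m e F \<Omega> = {w \<in> \<Omega>. F w \<in> alg_units m e}"

(* The derivative of a piecewise C1 curve in the library's sense may be unbounded near the finitely
   many break points. The gauge integral below still exists for such curves, and they give no
   values beyond those of curves whose derivative has one-sided limits. *)
definition admissible_curve ::
  "(real^3) set \<Rightarrow> real \<Rightarrow> (real \<Rightarrow> real^3) \<Rightarrow> real^3 \<Rightarrow> real^3 \<Rightarrow> bool" where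
  "admissible_curve R a \<gamma> p q \<longleftrightarrow>
     0 < a \<and> \<gamma> piecewise_C1_differentiable_on {0..a} \<and> \<gamma> ` {0..a} \<subseteq> R \<and>
     \<gamma> 0 = p \<and> \<gamma> a = q"

definition line_integral_inverse ::
  "(real^3 \<Rightarrow> real^3 \<Rightarrow> real^3) \<Rightarrow> real^3 \<Rightarrow> (real^3 \<Rightarrow> real^3) \<Rightarrow>
     real \<Rightarrow> (real \<Rightarrow> real^3) \<Rightarrow> real^3" where
  "line_integral_inverse m e F a \<gamma> =
     integral {0..a}
       (\<lambda>t. m (alg_inverse m e (F (\<gamma> t))) (vector_derivative \<gamma> (at t within {0..a})))"

(* A multivalued function is represented by the function sending a point to its set of values.
   The argument base assigns to each connected component of R its base point. *)
definition multivalued_integral ::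
  "(real^3 \<Rightarrow> real^3 \<Rightarrow> real^3) \<Rightarrow> real^3 \<Rightarrow> (real^3 \<Rightarrow> real^3) \<Rightarrow> (real^3) set \<Rightarrow>
     ((real^3) set \<Rightarrow> real^3) \<Rightarrow> real^3 \<Rightarrow> (real^3) set" where
  "multivalued_integral m e F R base w =
     {line_integral_inverse m e F a \<gamma> | a \<gamma>.
        admissible_curve R a \<gamma> (base (connected_component_set R w)) w}"

definition C1_on :: "(real^3) set \<Rightarrow> (real^3 \<Rightarrow> real^3) \<Rightarrow> bool" where
  "C1_on S f \<longleftrightarrow>
     (\<exists>f' :: real^3 \<Rightarrow> (real^3) \<Rightarrow>\<^sub>L (real^3). continuous_on S f' \<and>
        (\<forall>x\<in>S. (f has_derivative blinfun_apply (f' x)) (at x)))"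

definition diffeomorphism_between ::
  "(real^3) set \<Rightarrow> (real^3) set \<Rightarrow> (real^3 \<Rightarrow> real^3) \<Rightarrow> bool" where
  "diffeomorphism_between N V h \<longleftrightarrow>
     open N \<and> open V \<and> bij_betw h N V \<and> C1_on N h \<and> C1_on V (inv_into N h)"

(* Any two values of an integral of e/F at a point differ by a period, and the periods form a
   countable group, so continuous selections over a connected set are determined by one value. *)
definition branch_on ::
  "(real^3 \<Rightarrow> (real^3) set) \<Rightarrow> (real^3) set \<Rightarrow> (real^3 \<Rightarrow> real^3) \<Rightarrow> bool" where
  "branch_on H N h \<longleftrightarrow> open N \<and> continuous_on N h \<and> (\<forall>w\<in>N. h w \<in> H w)"

(* A multivalued function on U has at least one value at every point of U; the first conjunct
   records this and keeps the quantification over the values from being vacuous. *)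
definition multivalued_rectification ::
  "(real^3 \<Rightarrow> (real^3) set) \<Rightarrow> (real^3) set \<Rightarrow> (real^3 \<Rightarrow> real^3) \<Rightarrow> real^3 \<Rightarrow> bool" where
  "multivalued_rectification H U F c \<longleftrightarrow>
     (\<forall>w\<^sub>0\<in>U. H w\<^sub>0 \<noteq> {} \<and>
        (\<exists>N. open N \<and> w\<^sub>0 \<in> N \<and> N \<subseteq> U \<and>
           (\<forall>k\<in>H w\<^sub>0. \<exists>V h. open V \<and> k \<in> V \<and>
              diffeomorphism_between N V h \<and> branch_on H N h \<and> h w\<^sub>0 = k \<and>
              (\<forall>w\<in>N. frechet_derivative h (at w) (F w) = c))))"

(* Coefficients are required to be differentiable only: that is the regularity inherited from F. *)
definition riemannian_metric_on ::
  "(real^3) set \<Rightarrow> (real^3 \<Rightarrow> real^3 \<Rightarrow> real^3 \<Rightarrow> real) \<Rightarrow> bool" where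
  "riemannian_metric_on U g \<longleftrightarrow>
     (\<forall>w\<in>U. bilinear (g w) \<and> (\<forall>u v. g w u v = g w v u) \<and> (\<forall>u. u \<noteq> 0 \<longrightarrow> 0 < g w u u)) \<and>
     (\<forall>u v. (\<lambda>w. g w u v) differentiable_on U)"

definition natural_metric :: "real^3 \<Rightarrow> real^3 \<Rightarrow> real^3 \<Rightarrow> real" where
  "natural_metric w u v = u \<bullet> v"

(* p is the pullback of the metric lam under the multivalued function H: every point lies in the
   domain of a differentiable branch, and any such branch computes p there. *)
definition is_multivalued_pullback ::
  "(real^3 \<Rightarrow> (real^3) set) \<Rightarrow> (real^3) set \<Rightarrow> (real^3 \<Rightarrow> real^3 \<Rightarrow> real^3 \<Rightarrow> real) \<Rightarrow>
     (real^3 \<Rightarrow> real^3 \<Rightarrow> real^3 \<Rightarrow> real) \<Rightarrow> bool" where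
  "is_multivalued_pullback H U lam p \<longleftrightarrow>
     (\<forall>w\<in>U.
        (\<exists>N h. w \<in> N \<and> N \<subseteq> U \<and> branch_on H N h \<and> h differentiable_on N) \<and>
        (\<forall>N h. w \<in> N \<and> N \<subseteq> U \<and> branch_on H N h \<and> h differentiable_on N \<longrightarrow>
           (\<forall>u v. p w u v =
              lam (h w) (frechet_derivative h (at w) u) (frechet_derivative h (at w) v))))"

end

theory Submission
  imports Defs
begin

text \<open>
Everything rests on local primitives of the reciprocal \<open>G = e/F\<close> on the regular domain.
Inversion in the algebra is differentiable (\<open>inverse_has_derivative\<close>), and by the chain rule \<open>G\<close>
has, like \<open>F\<close>, a derivative that is at each point the multiplication by an element of the
algebra. For such maps Goursat's proof for complex functions carries over (\<open>Goursat_triangle\<close>):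
affine maps of this kind have primitives, and quadrisection of triangles works for derivatives
that may be discontinuous. Hence \<open>G\<close> has a primitive \<open>h\<close> on every convex open subset of the
regular domain, where \<open>h\<close> has derivative \<open>\<lambda>v. G w \<odot> v\<close> at \<open>w\<close> (\<open>convex_primitive\<close>).

Prolonging curves by segments shows that near a point \<open>w0\<close> the values of \<open>H\<close> at \<open>w\<close> are its
values at \<open>w0\<close> shifted by \<open>h w - h w0\<close> (\<open>values_transport\<close>). So for each value \<open>k\<close> at \<open>w0\<close> the
function \<open>\<lambda>w. h w + (k - h w0)\<close> is a branch of \<open>H\<close>. Its derivative at \<open>w\<close> is multiplication by
the unit \<open>G w\<close>, hence invertible, and the inverse function theorem makes these branches local
diffeomorphisms on one common neighbourhood. They send \<open>F w\<close> to \<open>G w \<odot> F w = e\<close>, which is the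
rectification.

The metric is \<open>(G w \<odot> u) \<bullet> (G w \<odot> v)\<close>, divided by the square of the norm of \<open>e\<close>. It is positive
definite because \<open>G w\<close> is a unit, and its coefficients are differentiable because \<open>G\<close> is. The
point to be shown is that every branch of \<open>H\<close> computes it, also a branch that is not built from
a primitive. For this, \<open>H\<close> must have only countably many values at each point
(\<open>countable_values\<close>): the integral over a curve depends only on the end points and on a finite
chain of convex sets, taken from a countable cover, through which the curve runs. A branch minus
a primitive is then a continuous function with countably many values on a ball, hence constant,
so the derivative of the branch is multiplication by \<open>G w\<close> as well (\<open>branch_derivative\<close>).
\<close>

section \<open>Integrals over segments in a commutative algebra\<close>

text \<open>
Primitives are constructed for any commutative and associative bilinear product on a Euclidean
space; the unit enters when elements are inverted.
\<close>

locale assoc_comm_product =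
  fixes mult :: "'a::euclidean_space \<Rightarrow> 'a \<Rightarrow> 'a"  (infixl "\<odot>" 70)
  assumes bilinear_mult: "bilinear (\<odot>)"
    and mult_assoc: "(a \<odot> b) \<odot> c = a \<odot> (b \<odot> c)"
    and mult_commute: "a \<odot> b = b \<odot> a"
begin

sublocale product: bounded_bilinear "(\<odot>)"
  using bilinear_mult by (simp add: bilinear_conv_bounded_bilinear)

definition segment_integral :: "('a \<Rightarrow> 'a) \<Rightarrow> 'a \<Rightarrow> 'a \<Rightarrow> 'a" where
  "segment_integral G a b = integral {0..1} (\<lambda>t. G (linepath a b t) \<odot> (b - a))"

lemma continuous_on_segment_integrand:
  assumes "continuous_on (closed_segment a b) G"
  shows "continuous_on {0..1} (\<lambda>t. G (linepath a b t) \<odot> c)"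
proof -
  have "continuous_on {0..1} (\<lambda>t. G (linepath a b t))"
    by (rule continuous_on_compose2[OF assms continuous_on_linepath])
       (auto simp: linepath_in_path)
  then show ?thesis
    by (intro product.continuous_on continuous_intros)
qed

lemma has_integral_segment_integral:
  assumes "continuous_on (closed_segment a b) G"
  shows "((\<lambda>t. G (linepath a b t) \<odot> (b - a)) has_integral segment_integral G a b) {0..1}"
  unfolding segment_integral_def
  by (intro integrable_integral integrable_continuous_real continuous_on_segment_integrand assms)

lemma segment_integral_reverse:
  "segment_integral G b a = - segment_integral G a b"
proof -
  let ?f = "\<lambda>t. G (linepath a b t) \<odot> (a - b)"
  have "segment_integral G b a = integral {0..1} (\<lambda>t. ?f (1 - t))"
    by (simp add: segment_integral_def linepath_def add.commute)
  also have "\<dots> = integral {-1..0} (\<lambda>t. ?f (- t))"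
    using integral_shift_real_ivl[of "-1" "-1" 0 "\<lambda>t. ?f (- t)"] by simp
  also have "\<dots> = integral {0..1} ?f"
    using Henstock_Kurzweil_Integration.integral_reflect_real[of 1 0 ?f] by simp
  also have "\<dots> = - segment_integral G a b"
    unfolding segment_integral_def integral_neg[symmetric]
    by (simp flip: product.minus_right)
  finally show ?thesis .
qed

lemma segment_integral_midpoint:
  assumes "continuous_on (closed_segment a b) G"
  shows "segment_integral G a b
    = segment_integral G a (midpoint a b) + segment_integral G (midpoint a b) b"
proof -
  let ?c = "midpoint a b"
  have sub: "closed_segment a ?c \<subseteq> closed_segment a b" "closed_segment ?c b \<subseteq> closed_segment a b"
    by (simp_all add: subset_closed_segment)
  have half: "?c - a = (1/2) *\<^sub>R (b - a)" "b - ?c = (1/2) *\<^sub>R (b - a)"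
    by (auto simp: midpoint_def algebra_simps simp flip: scaleR_left_distrib)
  have "(2 * t) *\<^sub>R ?c = t *\<^sub>R (a + b)" for t
    by (simp add: midpoint_def)
  moreover have "(1 - (2 * t - 1)) *\<^sub>R ?c = (1 - t) *\<^sub>R (a + b)" for t
  proof -
    have "(1 - (2 * t - 1)) * inverse 2 = 1 - t"
      by simp
    then show ?thesis
      unfolding midpoint_def scaleR_scaleR by simp
  qed
  moreover have "t *\<^sub>R (a + b) + (1 - 2 * t) *\<^sub>R a = linepath a b t"
    "(1 - t) *\<^sub>R (a + b) + (2 * t - 1) *\<^sub>R b = linepath a b t" for t
    by (simp_all add: linepath_def algebra_simps flip: scaleR_left_distrib)
  ultimately have param: "linepath a ?c (2 * t) = linepath a b t" "linepath ?c b (2 * t - 1) = linepath a b t" for t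
    unfolding linepath_def[of _ ?c] linepath_def[of ?c] by (simp_all add: add.commute)
  have "((\<lambda>t. G (linepath a ?c (2 *\<^sub>R t + 0)) \<odot> (?c - a)) has_integral
      (segment_integral G a ?c) /\<^sub>R 2 ^ DIM(real)) (cbox ((0 - 0) /\<^sub>R 2) ((1 - 0) /\<^sub>R 2))"
    using has_integral_affinity'[of "\<lambda>t. G (linepath a ?c t) \<odot> (?c - a)" _ 0 1 2 0]
      has_integral_segment_integral[OF continuous_on_subset[OF assms sub(1)]] by simp
  then have 1: "((\<lambda>t. G (linepath a b t) \<odot> (b - a)) has_integral segment_integral G a ?c) {0..1/2}"
    using has_integral_cmul[of _ _ "{0..1/2}" 2]
    by (fastforce simp: param half product.scaleR_right)
  have "((\<lambda>t. G (linepath ?c b (2 *\<^sub>R t + (-1))) \<odot> (b - ?c)) has_integral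
      (segment_integral G ?c b) /\<^sub>R 2 ^ DIM(real)) (cbox ((0 - (-1)) /\<^sub>R 2) ((1 - (-1)) /\<^sub>R 2))"
    using has_integral_affinity'[of "\<lambda>t. G (linepath ?c b t) \<odot> (b - ?c)" _ 0 1 2 "-1"]
      has_integral_segment_integral[OF continuous_on_subset[OF assms sub(2)]] by simp
  then have 2: "((\<lambda>t. G (linepath a b t) \<odot> (b - a)) has_integral segment_integral G ?c b) {1/2..1}"
    using has_integral_cmul[of _ _ "{1/2..1}" 2]
    by (fastforce simp: param half product.scaleR_right)
  have "((\<lambda>t. G (linepath a b t) \<odot> (b - a)) has_integral
      segment_integral G a ?c + segment_integral G ?c b) {0..1}"
    by (rule has_integral_combine[OF _ _ 1 2]) auto
  then show ?thesis
    unfolding segment_integral_def[of G a b] by (rule integral_unique)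
qed

text \<open>
If \<open>G\<close> is uniformly close to a map \<open>g\<close> with primitive \<open>P\<close>, then its integral is close to the
increment of \<open>P\<close>. In Goursat's argument \<open>g\<close> is the affine Taylor polynomial of \<open>G\<close>; for the
differentiability of the primitive it is a constant.
\<close>

lemma segment_integral_approx:
  assumes cont: "continuous_on (closed_segment a b) G"
    and primitive: "\<And>y. (P has_derivative (\<odot>) (g y)) (at y)"
    and close: "\<And>y. y \<in> closed_segment a b \<Longrightarrow> norm (G y - g y) \<le> B"
    and K: "\<And>x y. norm (x \<odot> y) \<le> norm x * norm y * K" "0 \<le> K"
  shows "norm (segment_integral G a b - (P b - P a)) \<le> B * norm (b - a) * K"
proof -
  let ?l = "linepath a b"
  have "((\<lambda>t. g (?l t) \<odot> (b - a)) has_integral ((P \<circ> ?l) 1 - (P \<circ> ?l) 0)) {0..1}"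
  proof (rule fundamental_theorem_of_calculus)
    fix t :: real
    have "(P \<circ> ?l has_derivative (\<odot>) (g (?l t)) \<circ> (\<lambda>x. x *\<^sub>R (b - a))) (at t within {0..1})"
      using has_vector_derivative_linepath_within[of a b t "{0..1}"]
      by (intro diff_chain_within has_derivative_at_withinI[OF primitive])
         (simp add: has_vector_derivative_def)
    then show "(P \<circ> ?l has_vector_derivative g (?l t) \<odot> (b - a)) (at t within {0..1})"
      by (simp add: has_vector_derivative_def comp_def product.scaleR_right)
  qed simp
  then have P: "((\<lambda>t. g (?l t) \<odot> (b - a)) has_integral (P b - P a)) {0..1}"
    by (simp add: linepath_def)
  have "((\<lambda>t. G (?l t) \<odot> (b - a) - g (?l t) \<odot> (b - a)) has_integral
      (segment_integral G a b - (P b - P a))) (cbox 0 1)"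
    using has_integral_diff[OF has_integral_segment_integral[OF cont] P] by simp
  moreover have "norm (G (?l t) \<odot> (b - a) - g (?l t) \<odot> (b - a)) \<le> B * norm (b - a) * K"
    if "t \<in> cbox 0 1" for t
  proof -
    have "norm (G (?l t) - g (?l t)) \<le> B"
      using that by (intro close) (auto simp: linepath_in_path)
    then have "norm (G (?l t) - g (?l t)) * norm (b - a) * K \<le> B * norm (b - a) * K"
      using K(2) by (intro mult_right_mono) auto
    then show ?thesis
      using K(1)[of "G (?l t) - g (?l t)" "b - a"] by (simp add: product.diff_left)
  qed
  moreover have "0 \<le> B * norm (b - a) * K"
    using K(2) order_trans[OF norm_ge_zero close[of a]] by simp
  ultimately have "norm (segment_integral G a b - (P b - P a))
      \<le> B * norm (b - a) * K * measure lborel (cbox 0 (1::real))"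
    by (intro has_integral_bound)
  then show ?thesis by simp
qed

section \<open>Goursat's theorem and primitives\<close>

text \<open>
Commutativity makes the derivative of the square \<open>(y - x) \<odot> (y - x)\<close> twice the product with
\<open>y - x\<close>, and associativity lets \<open>q\<close> be moved inside. So affine maps with a linear part that is a
multiplication have primitives, as complex affine maps do.
\<close>

lemma affine_primitive:
  "((\<lambda>y. p \<odot> y + (1/2) *\<^sub>R (q \<odot> ((y - x) \<odot> (y - x)))) has_derivative
     (\<odot>) (p + q \<odot> (y - x))) (at y)"
proof -
  have "(1/2) *\<^sub>R (q \<odot> ((y - x) \<odot> h + h \<odot> (y - x))) = (q \<odot> (y - x)) \<odot> h" for h
    by (simp add: mult_commute[of h] product.add_right mult_assoc flip: scaleR_left_distrib)
  then show ?thesis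
    by (auto intro!: derivative_eq_intros product.FDERIV
        simp: product.add_left product.zero_left fun_eq_iff)
qed

text \<open>
The edge midpoints cut a triangle into four triangles of half the diameter. The inner edges
cancel in the sum of the four boundary integrals, so one of these is at least a quarter of the
original.
\<close>

lemma triangle_quadrisection:
  assumes cont: "continuous_on (convex hull {a, b, c}) G"
    and small: "dist a b \<le> d" "dist b c \<le> d" "dist c a \<le> d"
    and large: "\<epsilon> * d\<^sup>2 \<le> norm (segment_integral G a b + segment_integral G b c + segment_integral G c a)"
  obtains a' b' c' where "convex hull {a', b', c'} \<subseteq> convex hull {a, b, c}"
    "dist a' b' \<le> d / 2" "dist b' c' \<le> d / 2" "dist c' a' \<le> d / 2"
    "\<epsilon> * (d / 2)\<^sup>2 \<le> norm (segment_integral G a' b' + segment_integral G b' c' + segment_integral G c' a')"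
proof -
  let ?S = "segment_integral G"
  define u v w where "u = midpoint b c" and "v = midpoint c a" and "w = midpoint a b"
  have seg: "continuous_on (closed_segment a b) G" "continuous_on (closed_segment b c) G"
    "continuous_on (closed_segment c a) G"
    by (rule continuous_on_subset[OF cont], simp add: segments_subset_convex_hull)+
  have "?S a b = ?S a w + ?S w b" "?S b c = ?S b u + ?S u c" "?S c a = ?S c v + ?S v a"
    unfolding u_def v_def w_def by (intro segment_integral_midpoint seg)+
  moreover have "?S w v = - ?S v w" "?S u w = - ?S w u" "?S v u = - ?S u v"
    by (rule segment_integral_reverse)+
  ultimately have "?S a b + ?S b c + ?S c a = (?S a w + ?S w v + ?S v a) + (?S w b + ?S b u + ?S u w)
      + ((?S u c + ?S c v + ?S v u) + (?S v w + ?S w u + ?S u v))"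
    by (simp add: algebra_simps)
  moreover have "e / 4 \<le> norm p \<or> e / 4 \<le> norm q \<or> e / 4 \<le> norm r \<or> e / 4 \<le> norm s"
    if "e \<le> norm ((p + q) + (r + s))" for e and p q r s :: 'a
    using that norm_triangle_ineq[of "p + q" "r + s"] norm_triangle_ineq[of p q]
      norm_triangle_ineq[of r s] by linarith
  ultimately consider "\<epsilon> * (d / 2)\<^sup>2 \<le> norm (?S a w + ?S w v + ?S v a)"
    | "\<epsilon> * (d / 2)\<^sup>2 \<le> norm (?S w b + ?S b u + ?S u w)"
    | "\<epsilon> * (d / 2)\<^sup>2 \<le> norm (?S u c + ?S c v + ?S v u)"
    | "\<epsilon> * (d / 2)\<^sup>2 \<le> norm (?S v w + ?S w u + ?S u v)"
    using large by (fastforce simp: power_divide)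
  note cases = this
  have mid: "u \<in> convex hull {a, b, c}" "v \<in> convex hull {a, b, c}" "w \<in> convex hull {a, b, c}"
    unfolding u_def v_def w_def by (auto simp: midpoints_in_convex_hull hull_inc)
  have "v - w = (1/2) *\<^sub>R (c - b)" "u - w = (1/2) *\<^sub>R (c - a)" "u - v = (1/2) *\<^sub>R (b - a)"
    unfolding u_def v_def w_def by (simp_all add: midpoint_def algebra_simps)
  then have inner: "dist v w \<le> d / 2" "dist w u \<le> d / 2" "dist u v \<le> d / 2"
      "dist w v \<le> d / 2" "dist u w \<le> d / 2" "dist v u \<le> d / 2"
    using small by (simp_all add: dist_norm norm_minus_commute)
  have outer: "dist a w \<le> d / 2" "dist w b \<le> d / 2" "dist b u \<le> d / 2" "dist u c \<le> d / 2"
    "dist c v \<le> d / 2" "dist v a \<le> d / 2"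
    using small unfolding u_def v_def w_def by (auto simp: dist_midpoint)
  have hulls: "convex hull {a, w, v} \<subseteq> convex hull {a, b, c}"
    "convex hull {w, b, u} \<subseteq> convex hull {a, b, c}"
    "convex hull {u, c, v} \<subseteq> convex hull {a, b, c}"
    "convex hull {v, w, u} \<subseteq> convex hull {a, b, c}"
    by (intro hull_minimal; simp add: mid hull_inc)+
  show thesis
    using cases
  proof cases
    case 1 show ?thesis by (rule that[OF hulls(1) outer(1) inner(4) outer(6) 1])
  next
    case 2 show ?thesis by (rule that[OF hulls(2) outer(2,3) inner(5) 2])
  next
    case 3 show ?thesis by (rule that[OF hulls(3) outer(4,5) inner(6) 3])
  next
    case 4 show ?thesis by (rule that[OF hulls(4) inner(1,2,3) 4])
  qed
qed

text \<open>
Replacing \<open>G\<close> by its Taylor polynomial at \<open>x\<close> changes each side integral by \<open>o(d)\<close> times the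
length of the side, and the Taylor polynomial has a primitive, so its integral over a closed
triangle vanishes. Hence the boundary integral is \<open>o(d\<^sup>2)\<close> for triangles of size \<open>d\<close> around \<open>x\<close>.
\<close>

lemma triangle_integral_local_bound:
  assumes deriv: "(G has_derivative (\<odot>) q) (at x within T)" and "\<epsilon> > 0"
  obtains \<delta> where "\<delta> > 0"
    "\<And>a b c d. \<lbrakk>x \<in> convex hull {a, b, c}; convex hull {a, b, c} \<subseteq> T;
       continuous_on (convex hull {a, b, c}) G;
       dist a b \<le> d; dist b c \<le> d; dist c a \<le> d; d < \<delta>\<rbrakk> \<Longrightarrow>
       norm (segment_integral G a b + segment_integral G b c + segment_integral G c a) \<le> \<epsilon> * d\<^sup>2"
proof -
  obtain K where K: "K > 0" "\<And>x y. norm (x \<odot> y) \<le> norm x * norm y * K"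
    using product.pos_bounded by blast
  \<comment> \<open>Three sides, each contributing at most \<open>\<eta> * d * d * K\<close>.\<close>
  define \<eta> where "\<eta> = \<epsilon> / (3 * K)"
  have "\<eta> > 0"
    using K \<open>\<epsilon> > 0\<close> by (simp add: \<eta>_def)
  then obtain \<delta> where \<delta>: "\<delta> > 0"
    "\<And>y. y \<in> T \<Longrightarrow> norm (y - x) < \<delta> \<Longrightarrow> norm (G y - G x - q \<odot> (y - x)) \<le> \<eta> * norm (y - x)"
    using deriv unfolding has_derivative_within_alt by blast
  let ?P = "\<lambda>y. G x \<odot> y + (1/2) *\<^sub>R (q \<odot> ((y - x) \<odot> (y - x)))"
  let ?S = "segment_integral G"
  show thesis
  proof (rule that[OF \<open>\<delta> > 0\<close>])
    fix a b c d
    assume x: "x \<in> convex hull {a, b, c}" and sub: "convex hull {a, b, c} \<subseteq> T"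
      and cont: "continuous_on (convex hull {a, b, c}) G"
      and dist: "dist a b \<le> d" "dist b c \<le> d" "dist c a \<le> d" and "d < \<delta>"
    have "d \<ge> 0"
      using dist(1) zero_le_dist[of a b] by linarith
    have near: "norm (y - x) \<le> d" if "y \<in> convex hull {a, b, c}" for y
    proof -
      have "x \<in> cball z d" if "z \<in> {a, b, c}" for z
      proof -
        have "convex hull {a, b, c} \<subseteq> cball z d"
          using that dist \<open>d \<ge> 0\<close> by (intro hull_minimal) (auto simp: dist_commute)
        then show ?thesis using x by blast
      qed
      then have "{a, b, c} \<subseteq> cball x d"
        by (simp add: dist_commute)
      then have "convex hull {a, b, c} \<subseteq> cball x d"
        by (rule hull_minimal) simp
      then show ?thesis
        using that by (auto simp: dist_norm norm_minus_commute)
    qed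
    have side: "norm (?S y z - (?P z - ?P y)) \<le> (\<eta> * d) * d * K"
      if "y \<in> {a, b, c}" "z \<in> {a, b, c}" "dist y z \<le> d" for y z
    proof -
      have sub': "closed_segment y z \<subseteq> convex hull {a, b, c}"
        using that by (intro closed_segment_subset) (auto simp: hull_inc)
      have "norm (?S y z - (?P z - ?P y)) \<le> (\<eta> * d) * norm (z - y) * K"
      proof (rule segment_integral_approx[OF continuous_on_subset[OF cont sub'] affine_primitive])
        fix w assume "w \<in> closed_segment y z"
        then have w: "w \<in> convex hull {a, b, c}"
          using sub' by blast
        then have "norm (G w - G x - q \<odot> (w - x)) \<le> \<eta> * norm (w - x)"
          using near[OF w] \<open>d < \<delta>\<close> sub by (intro \<delta>) auto
        also have "\<dots> \<le> \<eta> * d"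
          using near[OF w] \<open>\<eta> > 0\<close> by simp
        finally show "norm (G w - (G x + q \<odot> (w - x))) \<le> \<eta> * d"
          by (simp add: diff_diff_eq)
      qed (use K in auto)
      also have "\<dots> \<le> (\<eta> * d) * d * K"
        using that(3) K(1) \<open>\<eta> > 0\<close> \<open>d \<ge> 0\<close>
        by (intro mult_right_mono mult_left_mono) (auto simp: dist_norm norm_minus_commute)
      finally show ?thesis .
    qed
    have "?S a b + ?S b c + ?S c a
        = (?S a b - (?P b - ?P a)) + (?S b c - (?P c - ?P b)) + (?S c a - (?P a - ?P c))"
      by simp
    also have "norm \<dots> \<le> (\<eta> * d) * d * K + (\<eta> * d) * d * K + (\<eta> * d) * d * K"
      by (intro norm_triangle_mono side) (use dist in auto)
    also have "\<dots> = \<epsilon> * d\<^sup>2"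
      using K(1) by (simp add: \<eta>_def power2_eq_square)
    finally show "norm (?S a b + ?S b c + ?S c a) \<le> \<epsilon> * d\<^sup>2" .
  qed
qed

text \<open>
Repeated quadrisection of a triangle with nonzero boundary integral gives nested triangles of
size \<open>d / 2^n\<close> whose boundary integrals are at least \<open>\<epsilon> * (d / 2^n)\<^sup>2\<close>. They shrink to a point,
where this contradicts the local bound. The field is only assumed to be differentiable, so \<open>G\<close>
may have a discontinuous derivative; this is why the argument is Goursat's and not Green's
formula.
\<close>

theorem Goursat_triangle:
  assumes deriv: "\<And>x. x \<in> convex hull {a, b, c} \<Longrightarrow>
    \<exists>q. (G has_derivative (\<odot>) q) (at x within convex hull {a, b, c})"
  shows "segment_integral G a b + segment_integral G b c + segment_integral G c a = 0"
proof (rule ccontr)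
  let ?S = "segment_integral G"
  let ?T = "convex hull {a, b, c}"
  assume nonzero: "?S a b + ?S b c + ?S c a \<noteq> 0"
  have cont: "continuous_on ?T G"
    using deriv by (meson continuous_on_eq_continuous_within has_derivative_continuous)
  \<comment> \<open>The summand 1 keeps \<open>d\<close> positive without discussing degenerate triangles.\<close>
  define d where "d = 1 + dist a b + dist b c + dist c a"
  define \<epsilon> where "\<epsilon> = norm (?S a b + ?S b c + ?S c a) / d\<^sup>2"
  have "d > 0"
    unfolding d_def by (simp add: add_pos_nonneg)
  then have "\<epsilon> > 0"
    using nonzero by (simp add: \<epsilon>_def)
  define bad where "bad n t \<longleftrightarrow> (case t of (x, y, z) \<Rightarrow> convex hull {x, y, z} \<subseteq> ?T \<and>
      dist x y \<le> d / 2^n \<and> dist y z \<le> d / 2^n \<and> dist z x \<le> d / 2^n \<and>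
      \<epsilon> * (d / 2^n)\<^sup>2 \<le> norm (?S x y + ?S y z + ?S z x))" for n :: nat and t
  define tri :: "'a \<times> 'a \<times> 'a \<Rightarrow> 'a set" where "tri = (\<lambda>(x, y, z). convex hull {x, y, z})"
  have "bad 0 (a, b, c)"
    using \<open>d > 0\<close> by (auto simp: bad_def \<epsilon>_def d_def)
  moreover have "\<exists>t'. bad (Suc n) t' \<and> tri t' \<subseteq> tri t" if "bad n t" for n t
  proof -
    obtain x y z where t: "t = (x, y, z)"
      by (cases t)
    have sub: "convex hull {x, y, z} \<subseteq> ?T"
      and xyz: "dist x y \<le> d / 2^n" "dist y z \<le> d / 2^n" "dist z x \<le> d / 2^n"
        "\<epsilon> * (d / 2^n)\<^sup>2 \<le> norm (?S x y + ?S y z + ?S z x)"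
      using that by (simp_all add: t bad_def)
    obtain x' y' z' where "convex hull {x', y', z'} \<subseteq> convex hull {x, y, z}"
      "dist x' y' \<le> d / 2^n / 2" "dist y' z' \<le> d / 2^n / 2" "dist z' x' \<le> d / 2^n / 2"
      "\<epsilon> * (d / 2^n / 2)\<^sup>2 \<le> norm (?S x' y' + ?S y' z' + ?S z' x')"
      by (rule triangle_quadrisection[OF continuous_on_subset[OF cont sub] xyz])
    then have "bad (Suc n) (x', y', z') \<and> tri (x', y', z') \<subseteq> tri t"
      using sub by (simp add: bad_def tri_def t mult.commute)
    then show ?thesis by blast
  qed
  ultimately obtain t where t: "\<And>n. bad n (t n)" "\<And>n. tri (t (Suc n)) \<subseteq> tri (t n)"
    using dependent_nat_choice[of bad "\<lambda>n s s'. tri s' \<subseteq> tri s"] by metis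
  have "\<Inter>(range (\<lambda>n. tri (t n))) \<noteq> {}"
  proof (rule compact_nest)
    show "tri (t n) \<subseteq> tri (t m)" if "m \<le> n" for m n
      using lift_Suc_antimono_le[of "\<lambda>n. tri (t n)", OF t(2) that] .
  qed (auto simp: tri_def finite_imp_compact_convex_hull split: prod.splits)
  then obtain x where x: "\<And>n. x \<in> tri (t n)"
    by auto
  have hull_sub: "tri (t n) \<subseteq> ?T" for n
    using t(1)[of n] by (auto simp: bad_def tri_def split: prod.splits)
  then have "x \<in> ?T"
    using x by blast
  then obtain q where "(G has_derivative (\<odot>) q) (at x within ?T)"
    using deriv by blast
  then obtain \<delta> where \<delta>: "\<delta> > 0"
    "\<And>a b c d. \<lbrakk>x \<in> convex hull {a, b, c}; convex hull {a, b, c} \<subseteq> ?T;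
       continuous_on (convex hull {a, b, c}) G;
       dist a b \<le> d; dist b c \<le> d; dist c a \<le> d; d < \<delta>\<rbrakk> \<Longrightarrow>
       norm (?S a b + ?S b c + ?S c a) \<le> \<epsilon> / 2 * d\<^sup>2"
    using triangle_integral_local_bound[of G q x ?T "\<epsilon> / 2"] \<open>\<epsilon> > 0\<close> by auto
  obtain n where n: "d / 2^n < \<delta>"
    using \<open>d > 0\<close> \<open>\<delta> > 0\<close> real_arch_pow[of 2 "d / \<delta>"] by (auto simp: field_simps)
  obtain u v w where tn: "t n = (u, v, w)"
    by (cases "t n")
  have "norm (?S u v + ?S v w + ?S w u) \<le> \<epsilon> / 2 * (d / 2^n)\<^sup>2"
    using t(1)[of n] x[of n] hull_sub[of n] n
    by (intro \<delta>) (auto simp: tn bad_def tri_def intro: continuous_on_subset[OF cont])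
  moreover have "\<epsilon> * (d / 2^n)\<^sup>2 \<le> norm (?S u v + ?S v w + ?S w u)"
    using t(1)[of n] by (simp add: tn bad_def)
  moreover have "\<epsilon> * (d / 2^n)\<^sup>2 > 0"
    using \<open>d > 0\<close> \<open>\<epsilon> > 0\<close> by simp
  ultimately show False by simp
qed

text \<open>
The primitive is the integral over the segment from a fixed point. By Goursat's theorem its
increments are again integrals over segments, and continuity of \<open>G\<close> gives the derivative.
\<close>

theorem convex_primitive:
  assumes "open C" "convex C" and deriv: "\<And>x. x \<in> C \<Longrightarrow> \<exists>q. (G has_derivative (\<odot>) q) (at x)"
  obtains h where "\<And>x. x \<in> C \<Longrightarrow> (h has_derivative (\<odot>) (G x)) (at x)"
proof (cases "C = {}")
  case False
  then obtain x0 where "x0 \<in> C" by blast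
  define h where "h = segment_integral G x0"
  have cont: "continuous_on C G"
    using deriv by (meson continuous_at_imp_continuous_on has_derivative_continuous)
  have increment: "h y - h x = segment_integral G x y" if "x \<in> C" "y \<in> C" for x y
  proof -
    have "convex hull {x0, x, y} \<subseteq> C"
      using that \<open>x0 \<in> C\<close> \<open>convex C\<close> by (intro hull_minimal) auto
    then have "segment_integral G x0 x + segment_integral G x y + segment_integral G y x0 = 0"
      using deriv by (intro Goursat_triangle) (meson has_derivative_at_withinI subsetD)
    then show ?thesis
      by (simp add: h_def segment_integral_reverse[of G y x0] algebra_simps)
  qed
  obtain K where K: "K > 0" "\<And>x y. norm (x \<odot> y) \<le> norm x * norm y * K"
    using product.pos_bounded by blast
  have "(h has_derivative (\<odot>) (G x)) (at x)" if "x \<in> C" for x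
    unfolding has_derivative_at_alt
  proof (intro conjI allI impI)
    fix \<epsilon> :: real assume "\<epsilon> > 0"
    obtain r where r: "r > 0" "ball x r \<subseteq> C"
      using \<open>open C\<close> \<open>x \<in> C\<close> open_contains_ball by blast
    obtain s where s: "s > 0" "\<And>y. y \<in> C \<Longrightarrow> dist y x < s \<Longrightarrow> dist (G y) (G x) < \<epsilon> / K"
      using cont \<open>x \<in> C\<close> \<open>\<epsilon> > 0\<close> K(1) unfolding continuous_on_iff by (metis divide_pos_pos)
    have "norm (h y - h x - G x \<odot> (y - x)) \<le> \<epsilon> * norm (y - x)" if "norm (y - x) < min r s" for y
    proof -
      have near: "closed_segment x y \<subseteq> ball x (min r s)"
        using that r(1) s(1) by (intro closed_segment_subset) (auto simp: dist_norm norm_minus_commute)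
      then have "closed_segment x y \<subseteq> C"
        using r(2) subset_ball[of "min r s" r x] by simp
      then have "norm (segment_integral G x y - (G x \<odot> y - G x \<odot> x)) \<le> \<epsilon> / K * norm (y - x) * K"
        using near s(2) K
        by (intro segment_integral_approx[where g = "\<lambda>_. G x"] continuous_on_subset[OF cont])
           (auto simp: dist_norm norm_minus_commute less_imp_le subset_iff
              intro!: bounded_linear_imp_has_derivative product.bounded_linear_right)
      moreover have "y \<in> C"
        using that r(2) by (auto simp: dist_norm norm_minus_commute)
      ultimately show ?thesis
        using K(1) increment[OF \<open>x \<in> C\<close>] by (simp add: product.diff_right)
    qed
    then show "\<exists>d>0. \<forall>y. norm (y - x) < d \<longrightarrow> norm (h y - h x - G x \<odot> (y - x)) \<le> \<epsilon> * norm (y - x)"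
      using r(1) s(1) by (metis min_less_iff_conj)
  qed (rule product.bounded_linear_right)
  then show ?thesis
    by (rule that)
qed (use that in simp)

end


section \<open>Inversion in a unital algebra on the three-dimensional space\<close>

locale real3_algebra = assoc_comm_product mult
  for mult :: "real^3 \<Rightarrow> real^3 \<Rightarrow> real^3"  (infixl "\<odot>" 70) +
  fixes e :: "real^3"
  assumes unit_mult: "e \<odot> a = a"
begin

abbreviation units :: "(real^3) set" where
  "units \<equiv> alg_units (\<odot>) e"

abbreviation inverse_of :: "real^3 \<Rightarrow> real^3"  (\<open>\<iota>\<close>) where
  "\<iota> \<equiv> alg_inverse (\<odot>) e"

lemma unit_nonzero: "e \<noteq> 0"
  using unit_mult[of "axis 1 1"] by (auto simp: product.zero_left)

lemma inverse_eqI: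
  assumes "a \<odot> b = e"
  shows "\<iota> a = b"
  unfolding alg_inverse_def
proof (rule the_equality)
  fix c assume "a \<odot> c = e"
  then have "c = (a \<odot> c) \<odot> b"
    using assms by (metis mult_assoc mult_commute unit_mult)
  then show "c = b"
    using \<open>a \<odot> c = e\<close> by (simp add: unit_mult)
qed (fact assms)

lemma mult_inverse: "a \<odot> \<iota> a = e" if "a \<in> units"
  using that inverse_eqI by (auto simp: alg_units_def)

lemma inverse_cancel:
  assumes "a \<in> units"
  shows "\<iota> a \<odot> (a \<odot> x) = x" "a \<odot> (\<iota> a \<odot> x) = x"
  using mult_inverse[OF assms] by (metis mult_assoc mult_commute unit_mult)+

text \<open>
Multiplication by a unit \<open>a\<close> is bounded below, and this survives a small perturbation \<open>c\<close> of \<open>a\<close>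
with half the constant. In finite dimension the injective linear map \<open>(\<odot>) c\<close> is then onto, so it
hits \<open>e\<close>, and the lower bound applied to the preimage of \<open>e\<close> bounds the inverse.
\<close>

lemma units_locally_bounded_inverse:
  assumes "a \<in> units"
  obtains \<delta> M where "\<delta> > 0" "M > 0" "\<And>c. norm (c - a) < \<delta> \<Longrightarrow> c \<in> units \<and> norm (\<iota> c) \<le> M"
proof -
  obtain K where K: "K > 0" "\<And>x y. norm (x \<odot> y) \<le> norm x * norm y * K"
    using product.pos_bounded by blast
  \<comment> \<open>\<open>norm x \<le> L * norm (a \<odot> x)\<close>; the summand 1 makes \<open>L > 0\<close> evident.\<close>
  define L where "L = K * (norm (\<iota> a) + 1)"
  have "L > 0"
    using K(1) by (simp add: L_def add_nonneg_pos)
  have lower: "norm x \<le> 2 * L * norm (c \<odot> x)" if c: "norm (c - a) < 1 / (2 * L * K)" for c x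
  proof -
    have "norm x \<le> norm (\<iota> a) * norm (a \<odot> x) * K"
      using K(2)[of "\<iota> a" "a \<odot> x"] inverse_cancel(1)[OF assms] by simp
    also have "\<dots> \<le> L * norm (a \<odot> x)"
      using K(1) by (simp add: L_def algebra_simps)
    also have "norm (a \<odot> x) \<le> norm (c \<odot> x) + norm ((c - a) \<odot> x)"
      using norm_triangle_ineq4[of "c \<odot> x" "(c - a) \<odot> x"] by (simp add: product.diff_left)
    also have "norm ((c - a) \<odot> x) \<le> norm (c - a) * norm x * K"
      by (rule K(2))
    also have "\<dots> \<le> 1 / (2 * L * K) * norm x * K"
      using c K(1) by (intro mult_right_mono) auto
    also have "\<dots> = norm x / (2 * L)"
      using K(1) by simp
    finally have "norm x \<le> L * (norm (c \<odot> x) + norm x / (2 * L))"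
      using \<open>L > 0\<close> by simp
    then show ?thesis
      using \<open>L > 0\<close> by (simp add: field_simps)
  qed
  have "c \<in> units \<and> norm (\<iota> c) \<le> 2 * L * norm e" if c: "norm (c - a) < 1 / (2 * L * K)" for c
  proof -
    have lin: "linear ((\<odot>) c)"
      using product.bounded_linear_right bounded_linear.linear by blast
    have "x = 0" if "c \<odot> x = 0" for x
      using lower[OF c, of x] that by simp
    then have "inj ((\<odot>) c)"
      using lin linear_injective_0 by blast
    then have "surj ((\<odot>) c)"
      using lin linear_injective_imp_surjective by blast
    then obtain x where x: "c \<odot> x = e"
      by (metis surjD)
    then show ?thesis
      using lower[OF c, of x] inverse_eqI[OF x] by (auto simp: alg_units_def)
  qed
  then show thesis
    using \<open>L > 0\<close> K(1) unit_nonzero by (intro that[of "1 / (2 * L * K)" "2 * L * norm e"]) auto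
qed

lemma open_units: "open units"
  unfolding open_dist using units_locally_bounded_inverse
  by (metis dist_norm)

text \<open>
With \<open>y = \<iota> a \<odot> (c - a)\<close> one has \<open>\<iota> c - \<iota> a = - (\<iota> c \<odot> y)\<close>. Using this twice, the error of the
linear approximation is \<open>\<iota> c \<odot> y \<odot> y\<close>, which is quadratic in \<open>c - a\<close> since \<open>\<iota> c\<close> stays bounded.
\<close>

lemma inverse_has_derivative:
  assumes "a \<in> units"
  shows "(\<iota> has_derivative (\<lambda>h. - (\<iota> a \<odot> (\<iota> a \<odot> h)))) (at a)"
  unfolding has_derivative_at_alt
proof (intro conjI allI impI)
  let ?b = "\<iota> a"
  show "bounded_linear (\<lambda>h. - (?b \<odot> (?b \<odot> h)))"
    by (intro bounded_linear_minus bounded_linear_compose[OF product.bounded_linear_right]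
        product.bounded_linear_right)
  obtain K where K: "K > 0" "\<And>x y. norm (x \<odot> y) \<le> norm x * norm y * K"
    using product.pos_bounded by blast
  obtain \<delta> M where M: "\<delta> > 0" "M > 0" "\<And>c. norm (c - a) < \<delta> \<Longrightarrow> c \<in> units \<and> norm (\<iota> c) \<le> M"
    using units_locally_bounded_inverse[OF assms] by metis
  define D where "D = M * K * K * (norm ?b * K)\<^sup>2 + 1"
  have "D > 0"
    using M(2) K(1) by (simp add: D_def add_nonneg_pos)
  have bound: "norm (\<iota> c - ?b - - (?b \<odot> (?b \<odot> (c - a)))) \<le> D * norm (c - a) * norm (c - a)"
    if "norm (c - a) < \<delta>" for c
  proof -
    have c: "c \<in> units" "norm (\<iota> c) \<le> M"
      using M(3)[OF that] by auto
    let ?y = "?b \<odot> (c - a)"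
    have eq: "\<iota> c \<odot> ?y = ?b - \<iota> c"
    proof -
      have "\<iota> c \<odot> (?b \<odot> c) = ?b" "\<iota> c \<odot> (?b \<odot> a) = \<iota> c"
        using inverse_cancel(1)[OF c(1), of ?b] inverse_cancel(2)[OF assms, of "\<iota> c"]
        by (simp_all add: mult_commute[of ?b] mult_commute[of "\<iota> c" "_ \<odot> _"] mult_assoc)
      then show ?thesis
        by (simp add: product.diff_right)
    qed
    have "(\<iota> c \<odot> ?y) \<odot> ?y = ?b \<odot> ?y - \<iota> c \<odot> ?y"
      by (simp only: eq product.diff_left)
    then have "\<iota> c - ?b - - (?b \<odot> ?y) = (\<iota> c \<odot> ?y) \<odot> ?y"
      unfolding eq by simp
    also have "norm \<dots> \<le> norm (\<iota> c) * norm ?y * K * norm ?y * K"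
      using K(2)[of "\<iota> c" ?y] K by (intro order_trans[OF K(2)] mult_right_mono) auto
    also have "\<dots> = norm (\<iota> c) * (norm ?y * norm ?y) * (K * K)"
      by (simp add: algebra_simps)
    also have "\<dots> \<le> M * ((norm ?b * norm (c - a) * K) * (norm ?b * norm (c - a) * K)) * (K * K)"
      using c(2) M(2) K by (intro mult_right_mono mult_mono) auto
    also have "\<dots> \<le> D * norm (c - a) * norm (c - a)"
      by (simp add: D_def power2_eq_square algebra_simps)
    finally show ?thesis .
  qed
  fix \<epsilon> :: real assume "\<epsilon> > 0"
  have "norm (\<iota> c - ?b - - (?b \<odot> (?b \<odot> (c - a)))) \<le> \<epsilon> * norm (c - a)"
    if "norm (c - a) < min \<delta> (\<epsilon> / D)" for c
  proof -
    have "D * norm (c - a) \<le> \<epsilon>"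
      using that \<open>D > 0\<close> by (simp add: field_simps)
    then show ?thesis
      using bound[of c] that mult_right_mono[of "D * norm (c - a)" \<epsilon> "norm (c - a)"] by auto
  qed
  then show "\<exists>d>0. \<forall>c. norm (c - a) < d \<longrightarrow>
      norm (\<iota> c - ?b - - (?b \<odot> (?b \<odot> (c - a)))) \<le> \<epsilon> * norm (c - a)"
    using M(1) \<open>D > 0\<close> \<open>\<epsilon> > 0\<close> by (intro exI[of _ "min \<delta> (\<epsilon> / D)"]) auto
qed

end

lemma algebra_on_R3_iff: "algebra_on_R3 m e \<longleftrightarrow> real3_algebra m e"
  by (auto simp: algebra_on_R3_def real3_algebra_def real3_algebra_axioms_def assoc_comm_product_def)

section \<open>The reciprocal of an algebrizable field and its primitives\<close>

locale algebrizable_field = real3_algebra mult e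
  for mult :: "real^3 \<Rightarrow> real^3 \<Rightarrow> real^3"  (infixl "\<odot>" 70) and e :: "real^3" +
  fixes F :: "real^3 \<Rightarrow> real^3" and \<Omega> :: "(real^3) set"
  assumes open_domain: "open \<Omega>"
    and algebrizable: "algebrizable (\<odot>) F \<Omega>"
begin

abbreviation R :: "(real^3) set" where
  "R \<equiv> regular_domain (\<odot>) e F \<Omega>"

abbreviation G :: "real^3 \<Rightarrow> real^3" where
  "G w \<equiv> \<iota> (F w)"

lemma field_has_derivative:
  assumes "w \<in> \<Omega>"
  obtains q where "(F has_derivative (\<odot>) q) (at w)"
  using assms algebrizable product.bounded_linear_right
  unfolding algebrizable_def has_derivative_at by blast

lemma continuous_on_field: "continuous_on \<Omega> F"
  using field_has_derivative has_derivative_continuous continuous_at_imp_continuous_on by metis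

lemma open_regular_domain: "open R"
proof -
  have "R = \<Omega> \<inter> F -` units"
    by (auto simp: regular_domain_def)
  then show ?thesis
    using continuous_open_preimage[OF continuous_on_field open_domain open_units] by simp
qed

lemma regular_domainD: "w \<in> \<Omega>" "F w \<in> units" if "w \<in> R"
  using that by (auto simp: regular_domain_def)

text \<open>
The quotient rule: if the derivative of \<open>F\<close> at \<open>w\<close> is multiplication by \<open>q\<close>, that of \<open>G\<close> is
multiplication by \<open>- (G w \<odot> (G w \<odot> q))\<close>. So \<open>G\<close> is again algebrizable, as Goursat's theorem
requires.
\<close>

lemma reciprocal_has_derivative:
  assumes "w \<in> R"
  shows "\<exists>q. (G has_derivative (\<odot>) q) (at w)"
proof -
  obtain q where q: "(F has_derivative (\<odot>) q) (at w)"
    using field_has_derivative regular_domainD(1)[OF assms] by blast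
  have "(G has_derivative (\<lambda>h. - (G w \<odot> (G w \<odot> (q \<odot> h))))) (at w)"
    using has_derivative_compose[OF q inverse_has_derivative[OF regular_domainD(2)[OF assms]]]
    by simp
  moreover have "(\<lambda>h. - (G w \<odot> (G w \<odot> (q \<odot> h)))) = (\<odot>) (- (G w \<odot> (G w \<odot> q)))"
    by (simp add: mult_assoc product.minus_left fun_eq_iff)
  ultimately show ?thesis by metis
qed

lemma continuous_on_reciprocal: "continuous_on R G"
  using reciprocal_has_derivative has_derivative_continuous continuous_at_imp_continuous_on by metis

text \<open>
Convexity of the domain is part of the notion so that intersections of domains stay connected,
and two primitives differ there by a constant.
\<close>

definition primitive_on :: "(real^3) set \<Rightarrow> (real^3 \<Rightarrow> real^3) \<Rightarrow> bool" where
  "primitive_on C h \<longleftrightarrow> open C \<and> convex C \<and> C \<subseteq> R \<and> (\<forall>x\<in>C. (h has_derivative (\<odot>) (G x)) (at x))"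

lemma primitive_exists:
  assumes "open C" "convex C" "C \<subseteq> R"
  obtains h where "primitive_on C h"
  using convex_primitive[of C G] assms reciprocal_has_derivative
  unfolding primitive_on_def by (metis subsetD)

lemma primitive_increments_agree:
  assumes "primitive_on C h" "primitive_on C' h'"
    and "x \<in> C \<inter> C'" "y \<in> C \<inter> C'"
  shows "h x - h y = h' x - h' y"
proof -
  have "h x - h' x = h y - h' y"
  proof (rule has_derivative_zero_unique_connected[of "C \<inter> C'" "\<lambda>z. h z - h' z"])
    fix z assume "z \<in> C \<inter> C'"
    then have "((\<lambda>z. h z - h' z) has_derivative (\<lambda>v. G z \<odot> v - G z \<odot> v)) (at z)"
      using assms(1,2) by (intro has_derivative_diff) (auto simp: primitive_on_def)
    then show "((\<lambda>z. h z - h' z) has_derivative (\<lambda>v. 0)) (at z)"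
      by simp
  qed (use assms in \<open>auto simp: primitive_on_def convex_Int convex_connected\<close>)
  then show ?thesis
    by (simp add: algebra_simps)
qed

lemma primitive_continuous_on:
  assumes "primitive_on C h"
  shows "continuous_on C h"
  using assms has_derivative_continuous continuous_at_imp_continuous_on
  unfolding primitive_on_def by metis

text \<open>
The derivative of \<open>h\<close> at \<open>x\<close> is multiplication by \<open>G x\<close>, whose inverse is multiplication by
\<open>F x\<close>. So the inverse function theorem applies, and the local inverse is continuously
differentiable because \<open>F\<close> is continuous. The neighbourhood \<open>N\<close> serves all translates \<open>h + c\<close> at
once, as the definition of a multivalued rectification demands one neighbourhood for all values.
\<close>

lemma primitive_local_diffeomorphism:
  assumes "primitive_on C h" and "w0 \<in> C"
  obtains N where "open N" "w0 \<in> N" "N \<subseteq> C"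
    "\<And>c. diffeomorphism_between N ((\<lambda>x. h x + c) ` N) (\<lambda>x. h x + c)"
proof -
  let ?h' = "\<lambda>x. product.prod_right (G x)"
  have C: "open C" "C \<subseteq> R" and h: "\<And>x. x \<in> C \<Longrightarrow> (h has_derivative ?h' x) (at x)"
    using assms(1) by (auto simp: primitive_on_def)
  have cont_h': "continuous_on C ?h'"
    by (intro bounded_linear.continuous_on[OF product.bounded_linear_prod_right]
        continuous_on_subset[OF continuous_on_reciprocal C(2)])
  have "product.prod_right (F w0) o\<^sub>L ?h' w0 = id_blinfun"
    using inverse_cancel(2)[OF regular_domainD(2), of w0] C(2) \<open>w0 \<in> C\<close>
    by (intro blinfun_eqI) auto
  from inverse_function_theorem[OF C(1) h cont_h' \<open>w0 \<in> C\<close> this]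
  obtain N V g g' where N: "open N" "N \<subseteq> C" "w0 \<in> N" and V: "open V"
    and hom: "homeomorphism N V h g"
    and g: "\<And>y. y \<in> V \<Longrightarrow> (g has_derivative g' y) (at y)"
      "\<And>y. y \<in> V \<Longrightarrow> g' y = inv (?h' (g y))"
    by metis
  have gV: "g y \<in> N" "h (g y) = y" if "y \<in> V" for y
    using hom that by (auto simp: homeomorphism_def)
  have hN: "h x \<in> V" "g (h x) = x" if "x \<in> N" for x
    using hom that by (auto simp: homeomorphism_def)
  have g_deriv: "(g has_derivative product.prod_right (F (g y))) (at y)" if "y \<in> V" for y
  proof -
    have "g y \<in> R"
      using gV(1)[OF that] N(2) C(2) by blast
    then have "inv (?h' (g y)) = (\<odot>) (F (g y))"
      using inverse_cancel[OF regular_domainD(2), of "g y"]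
      by (intro inv_unique_comp) (auto simp: fun_eq_iff)
    then show ?thesis
      using g[OF that] by simp
  qed
  have "diffeomorphism_between N ((\<lambda>x. h x + c) ` N) (\<lambda>x. h x + c)" for c
    unfolding diffeomorphism_between_def
  proof (intro conjI)
    let ?V = "(\<lambda>x. h x + c) ` N"
    have mem: "y \<in> ?V \<longleftrightarrow> y - c \<in> V" for y
      using gV[of "y - c"] hN by (force simp: image_iff)
    have "?V = (\<lambda>y. y + c) ` V"
      using hom by (auto simp: homeomorphism_def)
    then show "open ?V"
      using V open_translation[of V c] by (simp add: add.commute)
    have inj: "inj_on (\<lambda>x. h x + c) N"
      by (rule inj_on_inverseI[where g = "\<lambda>y. g (y - c)"]) (simp add: hN)
    then show "bij_betw (\<lambda>x. h x + c) N ?V"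
      by (rule inj_on_imp_bij_betw)
    show "C1_on N (\<lambda>x. h x + c)"
      unfolding C1_on_def using h N(2)
      by (intro exI[of _ ?h'] conjI ballI continuous_on_subset[OF cont_h'])
         (auto intro!: derivative_eq_intros)
    have inverse: "inv_into N (\<lambda>x. h x + c) y = g (y - c)" if "y \<in> ?V" for y
      using that hN(2) inv_into_f_f[OF inj] by auto
    have shifted: "((\<lambda>y. g (y - c)) has_derivative product.prod_right (F (g (y - c)))) (at y)"
      if "y \<in> ?V" for y
    proof -
      have "((\<lambda>y. y - c) has_derivative (\<lambda>v. v)) (at y)"
        by (auto intro!: derivative_eq_intros)
      from has_derivative_compose[OF this, of g] show ?thesis
        using g_deriv that by (simp add: mem)
    qed
    have "continuous_on ?V (\<lambda>y. product.prod_right (F (g (y - c))))"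
    proof (intro bounded_linear.continuous_on[OF product.bounded_linear_prod_right]
        continuous_on_compose2[OF continuous_on_field])
      show "continuous_on ?V (\<lambda>y. g (y - c))"
        by (intro continuous_at_imp_continuous_on ballI has_derivative_continuous[OF shifted])
      show "(\<lambda>y. g (y - c)) ` ?V \<subseteq> \<Omega>"
      proof (rule image_subsetI)
        fix y assume "y \<in> ?V"
        then have "g (y - c) \<in> R"
          using gV(1) N(2) C(2) mem by blast
        then show "g (y - c) \<in> \<Omega>"
          by (rule regular_domainD(1))
      qed
    qed
    moreover have "(inv_into N (\<lambda>x. h x + c) has_derivative product.prod_right (F (g (y - c)))) (at y)"
      if "y \<in> ?V" for y
      using has_derivative_transform_within_open[OF shifted[OF that] \<open>open ?V\<close> that]
      by (simp add: inverse)
    ultimately show "C1_on ?V (inv_into N (\<lambda>x. h x + c))"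
      unfolding C1_on_def by blast
  qed (rule N)
  then show thesis
    by (rule that[OF N(1,3,2)])
qed

section \<open>Line integrals along curves\<close>

abbreviation integrand :: "real \<Rightarrow> (real \<Rightarrow> real^3) \<Rightarrow> real \<Rightarrow> real^3" where
  "integrand a \<gamma> t \<equiv> G (\<gamma> t) \<odot> vector_derivative \<gamma> (at t within {0..a})"

text \<open>
The fundamental theorem of calculus for the gauge integral tolerates finitely many exceptional
points without any bound on the derivative near them, so it also yields the existence of the
integral for every piecewise continuously differentiable curve.
\<close>

lemma integral_along_curve_in_primitive:
  assumes \<gamma>: "\<gamma> piecewise_C1_differentiable_on {0..a}"
    and prim: "primitive_on C h"
    and st: "0 \<le> s" "s \<le> t" "t \<le> a" and sub: "\<gamma> ` {s..t} \<subseteq> C"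
  shows "(integrand a \<gamma> has_integral h (\<gamma> t) - h (\<gamma> s)) {s..t}"
proof -
  obtain S where S: "finite S" "\<gamma> C1_differentiable_on {0..a} - S" and cont: "continuous_on {0..a} \<gamma>"
    using \<gamma> by (auto simp: piecewise_C1_differentiable_on_def)
  have "(integrand a \<gamma> has_integral (h \<circ> \<gamma>) t - (h \<circ> \<gamma>) s) {s..t}"
  proof (rule fundamental_theorem_of_calculus_interior_strong[OF S(1) st(2)])
    show "continuous_on {s..t} (h \<circ> \<gamma>)"
      using st sub primitive_continuous_on[OF prim]
      by (intro continuous_on_compose continuous_on_subset[OF cont])
         (auto intro: continuous_on_subset)
    fix \<tau> assume \<tau>: "\<tau> \<in> {s<..<t} - S"
    then have "(\<gamma> has_vector_derivative vector_derivative \<gamma> (at \<tau>)) (at \<tau>)"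
      using S(2) st by (auto simp: C1_differentiable_on_eq vector_derivative_works[symmetric])
    moreover from this have "vector_derivative \<gamma> (at \<tau> within {0..a}) = vector_derivative \<gamma> (at \<tau>)"
      using \<tau> st by (intro vector_derivative_at_within_ivl) auto
    ultimately have \<gamma>': "(\<gamma> has_derivative (\<lambda>x. x *\<^sub>R vector_derivative \<gamma> (at \<tau> within {0..a}))) (at \<tau>)"
      by (simp add: has_vector_derivative_def)
    have "\<gamma> \<tau> \<in> C"
      using \<tau> sub by auto
    then have "(h has_derivative (\<odot>) (G (\<gamma> \<tau>))) (at (\<gamma> \<tau>))"
      using prim by (simp add: primitive_on_def)
    from has_derivative_compose[OF \<gamma>' this]
    show "(h \<circ> \<gamma> has_vector_derivative integrand a \<gamma> \<tau>) (at \<tau>)"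
      by (simp add: has_vector_derivative_def comp_def product.scaleR_right)
  qed
  then show ?thesis by simp
qed

text \<open>
The parameter interval is divided equally, so that the chain alone, without a choice of dividing
points, is the combinatorial datum of a curve. Over a countable cover there are only countably
many chains.
\<close>

definition follows :: "(real^3) set list \<Rightarrow> real \<Rightarrow> (real \<Rightarrow> real^3) \<Rightarrow> bool" where
  "follows Bs a \<gamma> \<longleftrightarrow> Bs \<noteq> [] \<and>
     (\<forall>i<length Bs. \<gamma> ` {a * i / length Bs .. a * Suc i / length Bs} \<subseteq> Bs ! i)"

text \<open>
The Lebesgue number of the cover of the compact image and the uniform continuity of the curve
give a subdivision with the required property.
\<close>

lemma exists_followed_chain:
  assumes \<gamma>: "admissible_curve R a \<gamma> p q"
    and cover: "\<And>B. B \<in> \<B> \<Longrightarrow> open B" "R \<subseteq> \<Union>\<B>"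
  obtains Bs where "Bs \<in> lists \<B>" "follows Bs a \<gamma>"
proof -
  have "0 < a" and cont: "continuous_on {0..a} \<gamma>" and im: "\<gamma> ` {0..a} \<subseteq> R"
    using \<gamma> by (auto simp: admissible_curve_def piecewise_C1_differentiable_on_def)
  have "compact (\<gamma> ` {0..a})"
    using cont by (simp add: compact_continuous_image)
  moreover have "\<gamma> ` {0..a} \<noteq> {}"
    using \<open>0 < a\<close> by simp
  then have "\<B> \<noteq> {}"
    using im cover(2) by auto
  ultimately obtain \<delta> where \<delta>: "0 < \<delta>"
    "\<And>T. T \<subseteq> \<gamma> ` {0..a} \<Longrightarrow> diameter T < \<delta> \<Longrightarrow> \<exists>B\<in>\<B>. T \<subseteq> B"
    using Lebesgue_number_lemma[of "\<gamma> ` {0..a}" \<B>] im cover by blast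
  have "uniformly_continuous_on {0..a} \<gamma>"
    using cont by (simp add: compact_uniformly_continuous)
  then obtain \<eta> where \<eta>: "\<eta> > 0"
    "\<And>s t. s \<in> {0..a} \<Longrightarrow> t \<in> {0..a} \<Longrightarrow> dist t s < \<eta> \<Longrightarrow> dist (\<gamma> t) (\<gamma> s) < \<delta> / 2"
    unfolding uniformly_continuous_on_def using \<open>0 < \<delta>\<close> by (metis half_gt_zero)
  obtain n :: nat where n: "a / \<eta> < n"
    using reals_Archimedean2 by blast
  then have "n > 0"
    using \<open>0 < a\<close> \<open>\<eta> > 0\<close> by (metis divide_pos_pos less_trans of_nat_0_less_iff)
  have "\<exists>B\<in>\<B>. \<gamma> ` {a * i / n .. a * Suc i / n} \<subseteq> B" if "i < n" for i
  proof (rule \<delta>(2))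
    have "a * Suc i / n \<le> a"
      using that \<open>0 < a\<close> \<open>n > 0\<close> by (simp add: pos_divide_le_eq del: of_nat_Suc)
    moreover have "0 \<le> a * i / n"
      using \<open>0 < a\<close> by simp
    ultimately have piece: "{a * i / n .. a * Suc i / n} \<subseteq> {0..a}"
      by auto
    then show "\<gamma> ` {a * i / n .. a * Suc i / n} \<subseteq> \<gamma> ` {0..a}"
      by (rule image_mono)
    have "a * Suc i / n - a * i / n < \<eta>"
      using n \<open>n > 0\<close> \<open>\<eta> > 0\<close> by (simp add: field_simps)
    then have "dist (\<gamma> s) (\<gamma> t) \<le> \<delta> / 2"
      if "s \<in> {a * i / n .. a * Suc i / n}" "t \<in> {a * i / n .. a * Suc i / n}" for s t
      using that piece \<eta>(2)[of t s] by (force simp: dist_real_def)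
    then have "diameter (\<gamma> ` {a * i / n .. a * Suc i / n}) \<le> \<delta> / 2"
      using \<open>0 < \<delta>\<close> by (intro diameter_le) (auto simp: dist_norm)
    then show "diameter (\<gamma> ` {a * i / n .. a * Suc i / n}) < \<delta>"
      using \<open>0 < \<delta>\<close> by simp
  qed
  then obtain B where B: "\<And>i. i < n \<Longrightarrow> B i \<in> \<B> \<and> \<gamma> ` {a * i / n .. a * Suc i / n} \<subseteq> B i"
    by metis
  show thesis
  proof (rule that)
    show "map B [0..<n] \<in> lists \<B>"
      using B by auto
    show "follows (map B [0..<n]) a \<gamma>"
      using B \<open>n > 0\<close> by (auto simp: follows_def)
  qed
qed

text \<open>
Inside one member of the chain, integrals are increments of a primitive. So the difference of
the integrals over the two curves up to time step \<open>i\<close> is the increment of a primitive between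
the two current points; passing to the next member does not change this increment, because both
points lie in the convex intersection. At the end the two points coincide.
\<close>

lemma integrals_agree_along_chain:
  assumes \<gamma>: "admissible_curve R a \<gamma> p q" and \<gamma>': "admissible_curve R a' \<gamma>' p q"
    and follows: "follows Bs a \<gamma>" "follows Bs a' \<gamma>'"
    and prim: "\<And>B. B \<in> set Bs \<Longrightarrow> primitive_on B (h B)"
  obtains J where "(integrand a \<gamma> has_integral J) {0..a}" "(integrand a' \<gamma>' has_integral J) {0..a'}"
proof -
  define n where "n = length Bs"
  have "n > 0"
    using follows(1) by (simp add: n_def follows_def)
  have pos: "0 < a" "0 < a'"
    and C1: "\<gamma> piecewise_C1_differentiable_on {0..a}" "\<gamma>' piecewise_C1_differentiable_on {0..a'}"
    and ends: "\<gamma> 0 = p" "\<gamma>' 0 = p" "\<gamma> a = q" "\<gamma>' a' = q"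
    using \<gamma> \<gamma>' by (auto simp: admissible_curve_def)
  define t where "t b i = b * real i / real n" for b :: real and i :: nat
  have t: "0 \<le> t b i" "t b i \<le> t b (Suc i)" if "b > 0" for b i
    using that by (auto simp: t_def divide_right_mono)
  have t_le: "t b (Suc i) \<le> b" if "b > 0" "i < n" for b i
    using that by (simp add: t_def pos_divide_le_eq del: of_nat_Suc)
  have t_ends: "t b 0 = 0" "t b n = b" for b
    using \<open>n > 0\<close> by (auto simp: t_def)
  have piece: "\<gamma> ` {t a i .. t a (Suc i)} \<subseteq> Bs ! i" "\<gamma>' ` {t a' i .. t a' (Suc i)} \<subseteq> Bs ! i" if "i < n" for i
    using follows that by (auto simp: follows_def t_def n_def)
  have "\<exists>J J'. (integrand a \<gamma> has_integral J) {0..t a i} \<and> (integrand a' \<gamma>' has_integral J') {0..t a' i} \<and>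
      (\<forall>B\<in>set Bs. \<gamma> (t a i) \<in> B \<longrightarrow> \<gamma>' (t a' i) \<in> B \<longrightarrow> J - J' = h B (\<gamma> (t a i)) - h B (\<gamma>' (t a' i)))"
    if "i \<le> n" for i
    using that
  proof (induction i)
    case 0
    show ?case
      by (intro exI[of _ 0]) (auto simp: t_ends ends)
  next
    case (Suc i)
    define B where "B = Bs ! i"
    have i: "i < n" and B: "B \<in> set Bs"
      using Suc.prems by (auto simp: B_def n_def)
    obtain J J' where J: "(integrand a \<gamma> has_integral J) {0..t a i}"
      "(integrand a' \<gamma>' has_integral J') {0..t a' i}"
      and diff: "\<gamma> (t a i) \<in> B \<Longrightarrow> \<gamma>' (t a' i) \<in> B \<Longrightarrow> J - J' = h B (\<gamma> (t a i)) - h B (\<gamma>' (t a' i))"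
      using Suc B by auto
    have in_B: "\<gamma> (t a i) \<in> B" "\<gamma> (t a (Suc i)) \<in> B" "\<gamma>' (t a' i) \<in> B" "\<gamma>' (t a' (Suc i)) \<in> B"
      using piece[OF i] t(2)[OF pos(1), of i] t(2)[OF pos(2), of i] by (auto simp: B_def)
    let ?K = "J + (h B (\<gamma> (t a (Suc i))) - h B (\<gamma> (t a i)))"
    let ?K' = "J' + (h B (\<gamma>' (t a' (Suc i))) - h B (\<gamma>' (t a' i)))"
    have "(integrand a \<gamma> has_integral ?K) {0..t a (Suc i)}"
      by (rule has_integral_combine[OF t[OF pos(1)] J(1)
            integral_along_curve_in_primitive[OF C1(1) prim[OF B] t[OF pos(1)] t_le[OF pos(1) i]]])
         (use piece[OF i] in \<open>simp add: B_def\<close>)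
    moreover have "(integrand a' \<gamma>' has_integral ?K') {0..t a' (Suc i)}"
      by (rule has_integral_combine[OF t[OF pos(2)] J(2)
            integral_along_curve_in_primitive[OF C1(2) prim[OF B] t[OF pos(2)] t_le[OF pos(2) i]]])
         (use piece[OF i] in \<open>simp add: B_def\<close>)
    moreover have "?K - ?K' = h B' (\<gamma> (t a (Suc i))) - h B' (\<gamma>' (t a' (Suc i)))"
      if "B' \<in> set Bs" "\<gamma> (t a (Suc i)) \<in> B'" "\<gamma>' (t a' (Suc i)) \<in> B'" for B'
    proof -
      have "?K - ?K' = (J - J') - (h B (\<gamma> (t a i)) - h B (\<gamma>' (t a' i)))
          + (h B (\<gamma> (t a (Suc i))) - h B (\<gamma>' (t a' (Suc i))))"
        by simp
      also have "\<dots> = h B (\<gamma> (t a (Suc i))) - h B (\<gamma>' (t a' (Suc i)))"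
        using diff in_B by simp
      also have "\<dots> = h B' (\<gamma> (t a (Suc i))) - h B' (\<gamma>' (t a' (Suc i)))"
        using in_B that by (intro primitive_increments_agree[OF prim[OF B] prim[OF that(1)]]) auto
      finally show ?thesis .
    qed
    ultimately show ?case by blast
  qed
  from this[of n] obtain J J' where J: "(integrand a \<gamma> has_integral J) {0..a}"
    "(integrand a' \<gamma>' has_integral J') {0..a'}"
    and diff: "\<And>B. B \<in> set Bs \<Longrightarrow> q \<in> B \<Longrightarrow> J - J' = h B q - h B q"
    by (auto simp: t_ends ends)
  have "Bs ! (n - 1) \<in> set Bs" "q \<in> Bs ! (n - 1)"
    using piece(1)[of "n - 1"] \<open>n > 0\<close> t(2)[OF pos(1), of "n - 1"] ends(3) t_ends(2)[of a]
    by (auto simp: n_def)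
  then have "J = J'"
    using diff by fastforce
  then show thesis
    using J that by blast
qed

end


section \<open>The values of the multivalued integral\<close>

locale based_algebrizable_field = algebrizable_field mult e F \<Omega>
  for mult :: "real^3 \<Rightarrow> real^3 \<Rightarrow> real^3"  (infixl "\<odot>" 70) and e :: "real^3"
    and F :: "real^3 \<Rightarrow> real^3" and \<Omega> :: "(real^3) set" +
  fixes base :: "(real^3) set \<Rightarrow> real^3"
  assumes base_in_component: "C \<in> components R \<Longrightarrow> base C \<in> C"
begin

abbreviation H :: "real^3 \<Rightarrow> (real^3) set" where
  "H \<equiv> multivalued_integral (\<odot>) e F R base"

lemma value_iff:
  "k \<in> H w \<longleftrightarrow> (\<exists>a \<gamma>. admissible_curve R a \<gamma> (base (connected_component_set R w)) w \<and>
     k = integral {0..a} (integrand a \<gamma>))"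
  by (auto simp: multivalued_integral_def line_integral_inverse_def)

lemma countable_convex_cover:
  obtains \<B> where "countable \<B>" "\<Union>\<B> = R" "\<And>B. B \<in> \<B> \<Longrightarrow> open B \<and> convex B \<and> B \<subseteq> R"
proof -
  let ?\<U> = "{B. open B \<and> convex B \<and> B \<subseteq> R}"
  obtain \<B> where \<B>: "\<B> \<subseteq> ?\<U>" "countable \<B>" "\<Union>\<B> = \<Union>?\<U>"
    using Lindelof[of ?\<U>] by blast
  have "\<Union>?\<U> = R"
  proof
    show "R \<subseteq> \<Union>?\<U>"
    proof
      fix x assume "x \<in> R"
      then obtain r where "r > 0" "ball x r \<subseteq> R"
        using open_regular_domain open_contains_ball by blast
      then have "ball x r \<in> ?\<U>" "x \<in> ball x r"
        by auto
      then show "x \<in> \<Union>?\<U>" by blast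
    qed
  qed blast
  then show thesis
    using \<B> by (intro that[of \<B>]) auto
qed

lemma integrand_integrable:
  assumes "admissible_curve R a \<gamma> p q"
  shows "integrand a \<gamma> integrable_on {0..a}"
proof -
  obtain \<B> where \<B>: "\<Union>\<B> = R" "\<And>B. B \<in> \<B> \<Longrightarrow> open B \<and> convex B \<and> B \<subseteq> R"
    using countable_convex_cover by metis
  obtain Bs where Bs: "Bs \<in> lists \<B>" "follows Bs a \<gamma>"
    using exists_followed_chain[OF assms, of \<B>] \<B> by blast
  have "\<forall>B\<in>\<B>. \<exists>h. primitive_on B h"
    using \<B>(2) primitive_exists by metis
  then obtain h where "\<And>B. B \<in> \<B> \<Longrightarrow> primitive_on B (h B)"
    by metis
  then obtain J where "(integrand a \<gamma> has_integral J) {0..a}"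
    using integrals_agree_along_chain[OF assms assms Bs(2) Bs(2), of h] Bs(1) by (metis in_listsD)
  then show ?thesis by blast
qed

text \<open>
By the Lindeloef property there is a countable cover of the regular domain by convex open sets.
A value is determined by the finite chain of members that a curve follows, and there are
countably many finite chains. This replaces the countability of the fundamental group.
\<close>

theorem countable_values: "countable (H w)"
proof -
  let ?adm = "\<lambda>a \<gamma>. admissible_curve R a \<gamma> (base (connected_component_set R w)) w"
  obtain \<B> where \<B>: "countable \<B>" "\<Union>\<B> = R" "\<And>B. B \<in> \<B> \<Longrightarrow> open B \<and> convex B \<and> B \<subseteq> R"
    using countable_convex_cover by metis
  have "\<forall>B\<in>\<B>. \<exists>h. primitive_on B h"
    using \<B>(3) primitive_exists by metis
  then obtain h where h: "\<And>B. B \<in> \<B> \<Longrightarrow> primitive_on B (h B)"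
    by metis
  have "\<exists>Bs. Bs \<in> lists \<B> \<and> (\<exists>a \<gamma>. ?adm a \<gamma> \<and> k = integral {0..a} (integrand a \<gamma>) \<and> follows Bs a \<gamma>)"
    if k: "k \<in> H w" for k
  proof -
    obtain a \<gamma> where \<gamma>: "?adm a \<gamma>" "k = integral {0..a} (integrand a \<gamma>)"
      using k unfolding value_iff by blast
    obtain Bs where "Bs \<in> lists \<B>" "follows Bs a \<gamma>"
      using exists_followed_chain[OF \<gamma>(1), of \<B>] \<B> by blast
    then show ?thesis
      using \<gamma> by blast
  qed
  then have "\<forall>k\<in>H w. \<exists>Bs. Bs \<in> lists \<B> \<and>
      (\<exists>a \<gamma>. ?adm a \<gamma> \<and> k = integral {0..a} (integrand a \<gamma>) \<and> follows Bs a \<gamma>)"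
    by blast
  from bchoice[OF this] obtain chain where chain: "\<And>k. k \<in> H w \<Longrightarrow> chain k \<in> lists \<B>"
    "\<And>k. k \<in> H w \<Longrightarrow> \<exists>a \<gamma>. ?adm a \<gamma> \<and> k = integral {0..a} (integrand a \<gamma>) \<and> follows (chain k) a \<gamma>"
    by blast
  have "inj_on chain (H w)"
  proof (rule inj_onI)
    fix k k' assume k: "k \<in> H w" "k' \<in> H w" and eq: "chain k = chain k'"
    from chain(2)[OF k(1)] obtain a \<gamma>
      where \<gamma>: "?adm a \<gamma>" "k = integral {0..a} (integrand a \<gamma>)" "follows (chain k) a \<gamma>"
      by (elim exE conjE)
    from chain(2)[OF k(2), folded eq] obtain a' \<gamma>'
      where \<gamma>': "?adm a' \<gamma>'" "k' = integral {0..a'} (integrand a' \<gamma>')" "follows (chain k) a' \<gamma>'"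
      by (elim exE conjE)
    have "primitive_on B (h B)" if "B \<in> set (chain k)" for B
      using that chain(1)[OF k(1)] h by auto
    then obtain J where "(integrand a \<gamma> has_integral J) {0..a}" "(integrand a' \<gamma>' has_integral J) {0..a'}"
      by (rule integrals_agree_along_chain[OF \<gamma>(1) \<gamma>'(1) \<gamma>(3) \<gamma>'(3)])
    then show "k = k'"
      unfolding \<gamma>(2) \<gamma>'(2) by (simp add: integral_unique)
  qed
  moreover have "countable (chain ` H w)"
    by (rule countable_subset[OF image_subsetI countable_lists[OF \<B>(1)]]) (rule chain(1))
  ultimately show ?thesis
    by (rule countable_image_inj_on[rotated])
qed

lemma component_in_primitive_domain:
  assumes "primitive_on C h" "x \<in> C" "y \<in> C"
  shows "connected_component_set R x = connected_component_set R y"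
  using assms connected_component_maximal[of x C R] connected_component_eq[of y R x]
  by (auto simp: primitive_on_def convex_connected)

text \<open>
A curve that gives the value \<open>k\<close> at \<open>x\<close> is prolonged by the segment from \<open>x\<close> to \<open>y\<close>, run through
in one additional unit of time.
\<close>

lemma values_transport:
  assumes prim: "primitive_on C h" and x: "x \<in> C" and y: "y \<in> C" and k: "k \<in> H x"
  shows "k + (h y - h x) \<in> H y"
proof -
  let ?p = "base (connected_component_set R x)"
  obtain a \<gamma> where \<gamma>: "admissible_curve R a \<gamma> ?p x" and k_eq: "k = integral {0..a} (integrand a \<gamma>)"
    using k unfolding value_iff by blast
  have "0 < a" and C1: "\<gamma> piecewise_C1_differentiable_on {0..a}" and im: "\<gamma> ` {0..a} \<subseteq> R"
    and ends: "\<gamma> 0 = ?p" "\<gamma> a = x"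
    using \<gamma> by (auto simp: admissible_curve_def)
  define \<sigma> where "\<sigma> t = linepath x y (t - a)" for t
  define \<gamma>' where "\<gamma>' t = (if t \<le> a then \<gamma> t else \<sigma> t)" for t
  have "(\<sigma> has_vector_derivative y - x) (at t)" for t
    unfolding \<sigma>_def linepath_def by (auto intro!: derivative_eq_intros simp: algebra_simps)
  then have "\<sigma> C1_differentiable_on {a..a+1}"
    unfolding C1_differentiable_on_def by (intro exI[of _ "\<lambda>_. y - x"]) auto
  then have C1': "\<gamma>' piecewise_C1_differentiable_on {0..a+1}"
    unfolding \<gamma>'_def using \<open>0 < a\<close> ends
    by (intro piecewise_C1_differentiable_cases[OF C1 C1_differentiable_imp_piecewise])
       (auto simp: \<sigma>_def linepath_def)
  have C: "convex C" "C \<subseteq> R"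
    using prim by (auto simp: primitive_on_def)
  have segment: "\<gamma>' ` {a..a+1} \<subseteq> C"
  proof
    fix z assume "z \<in> \<gamma>' ` {a..a+1}"
    then obtain t where t: "a \<le> t" "t \<le> a + 1" "z = \<gamma>' t" by auto
    then have "z = \<sigma> t"
      using ends(2) by (auto simp: \<gamma>'_def \<sigma>_def linepath_def)
    then have "z \<in> closed_segment x y"
      using t by (auto simp: \<sigma>_def linepath_in_path)
    then show "z \<in> C"
      using closed_segment_subset[OF x y C(1)] by blast
  qed
  have "\<gamma>' ` {0..a+1} \<subseteq> R"
  proof -
    have "{0..a+1} = {0..a} \<union> {a..a+1}"
      using \<open>0 < a\<close> by auto
    moreover have "\<gamma>' ` {0..a} \<subseteq> R"
      using im by (auto simp: \<gamma>'_def)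
    ultimately show ?thesis
      using segment C(2) by (auto simp: image_Un)
  qed
  moreover have "\<gamma>' 0 = ?p" "\<gamma>' (a + 1) = y"
    using \<open>0 < a\<close> ends by (auto simp: \<gamma>'_def \<sigma>_def linepath_def)
  ultimately have adm: "admissible_curve R (a + 1) \<gamma>' ?p y"
    using \<open>0 < a\<close> C1' by (simp add: admissible_curve_def)
  have same: "integrand (a + 1) \<gamma>' t = integrand a \<gamma> t" if "t \<in> box 0 a" for t
  proof -
    have t: "0 < t" "t < a" using that by auto
    have "vector_derivative \<gamma>' (at t within {0..a+1}) = vector_derivative \<gamma>' (at t)"
      using t by (simp add: at_within_Icc_at)
    also have "\<dots> = vector_derivative \<gamma> (at t)"
    proof (rule vector_derivative_cong_eq)
      show "\<forall>\<^sub>F s in nhds t. s \<in> UNIV \<longrightarrow> \<gamma>' s = \<gamma> s"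
        using eventually_nhds_in_open[of "{..<a}" t] t
        by (auto elim!: eventually_mono simp: \<gamma>'_def)
    qed auto
    also have "\<dots> = vector_derivative \<gamma> (at t within {0..a})"
      using t by (simp add: at_within_Icc_at)
    finally show ?thesis
      using t by (simp add: \<gamma>'_def)
  qed
  have "(integrand a \<gamma> has_integral k) (cbox 0 a)"
    using integrand_integrable[OF \<gamma>] by (simp add: k_eq integrable_integral)
  then have "(integrand (a + 1) \<gamma>' has_integral k) {0..a}"
    using has_integral_spike_interior[of "integrand a \<gamma>" k 0 a] same by simp
  moreover have "(integrand (a + 1) \<gamma>' has_integral h y - h x) {a..a+1}"
    using integral_along_curve_in_primitive[OF C1' prim, of a "a + 1"] \<open>0 < a\<close> segment ends
    by (simp add: \<gamma>'_def \<sigma>_def linepath_def)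
  ultimately have "(integrand (a + 1) \<gamma>' has_integral k + (h y - h x)) {0..a+1}"
    using \<open>0 < a\<close> by (intro has_integral_combine[of 0 a "a + 1"]) auto
  then have "k + (h y - h x) = integral {0..a+1} (integrand (a + 1) \<gamma>')"
    by (simp add: integral_unique)
  then show ?thesis
    using adm component_in_primitive_domain[OF prim x y] unfolding value_iff by auto
qed

text \<open>
Two points of a connected open set are joined by a polynomial curve in it, in particular the
base point and \<open>w\<close>.
\<close>

lemma values_nonempty:
  assumes "w \<in> R"
  shows "H w \<noteq> {}"
proof -
  let ?C = "connected_component_set R w"
  have "base ?C \<in> ?C"
    using assms by (intro base_in_component componentsI)
  then obtain \<gamma> where \<gamma>: "polynomial_function \<gamma>" "path_image \<gamma> \<subseteq> ?C" "pathstart \<gamma> = base ?C" "pathfinish \<gamma> = w"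
    using connected_open_polynomial_connected[of ?C "base ?C" w] assms open_regular_domain
    by (auto simp: open_connected_component)
  obtain \<gamma>' where "polynomial_function \<gamma>'" "\<And>t. (\<gamma> has_vector_derivative \<gamma>' t) (at t)"
    using has_vector_derivative_polynomial_function[OF \<gamma>(1)] by metis
  then have "\<gamma> piecewise_C1_differentiable_on {0..1}"
    by (intro C1_differentiable_imp_piecewise)
       (auto simp: C1_differentiable_on_def intro!: exI[of _ \<gamma>'] continuous_on_polymonial_function)
  then have "admissible_curve R 1 \<gamma> (base ?C) w"
    using \<gamma>(2-4) connected_component_subset[of R w]
    by (auto simp: admissible_curve_def path_image_def pathstart_def pathfinish_def)
  then show ?thesis
    using value_iff[of _ w] by blast
qed

text \<open>
Subtracting a primitive \<open>h\<close> from a branch leaves a continuous function that takes its values in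
a translate of \<open>H w\<close>. That set is countable, while a connected set with two points is
uncountable; so the difference is constant.
\<close>

lemma branch_differs_by_constant:
  assumes branch: "branch_on H N b" and "N \<subseteq> R" "w \<in> N"
  obtains C h where "primitive_on C h" "w \<in> C" "C \<subseteq> N" "\<And>x. x \<in> C \<Longrightarrow> b x = h x + (b w - h w)"
proof -
  have "open N"
    using branch by (simp add: branch_on_def)
  then obtain r where r: "r > 0" "ball w r \<subseteq> N"
    using \<open>w \<in> N\<close> open_contains_ball by blast
  let ?C = "ball w r"
  have w: "w \<in> ?C" using r by simp
  obtain h where h: "primitive_on ?C h"
    using primitive_exists[of ?C] r(2) \<open>N \<subseteq> R\<close> by auto
  let ?d = "\<lambda>x. b x - h x"
  have "continuous_on ?C ?d"
    using branch r(2) primitive_continuous_on[OF h]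
    by (intro continuous_on_diff) (auto simp: branch_on_def intro: continuous_on_subset)
  then have conn: "connected (?d ` ?C)"
    by (simp add: connected_continuous_image convex_connected)
  have "?d ` ?C \<subseteq> (\<lambda>k. k - h w) ` H w"
  proof
    fix z assume "z \<in> ?d ` ?C"
    then obtain x where x: "x \<in> ?C" "z = b x - h x" by blast
    then have "b x \<in> H x"
      using branch r(2) by (auto simp: branch_on_def)
    then have "b x + (h w - h x) \<in> H w"
      using values_transport[OF h x(1) w] by blast
    then show "z \<in> (\<lambda>k. k - h w) ` H w"
      using x(2) by (intro image_eqI[of _ _ "b x + (h w - h x)"]) simp_all
  qed
  then have "countable (?d ` ?C)"
    using countable_values countable_image countable_subset by blast
  then have "?d x = ?d w" if "x \<in> ?C" for x
    using connected_uncountable[OF conn, of "?d x" "?d w"] that w by blast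
  then have "b x = h x + (b w - h w)" if "x \<in> ?C" for x
    using that by (metis add.commute add_diff_eq diff_add_cancel)
  then show thesis
    using that[OF h w r(2)] by blast
qed

text \<open>
A branch agrees with a primitive up to a constant near \<open>w\<close>. This is what makes the pulled back
metric independent of the branch.
\<close>

lemma branch_derivative:
  assumes "branch_on H N b" "N \<subseteq> R" "w \<in> N"
  shows "frechet_derivative b (at w) = (\<odot>) (G w)"
proof -
  obtain C h where h: "primitive_on C h" and C: "w \<in> C" "C \<subseteq> N"
    and b: "\<And>x. x \<in> C \<Longrightarrow> b x = h x + (b w - h w)"
    using branch_differs_by_constant[OF assms] by metis
  have C': "open C" "(h has_derivative (\<odot>) (G w)) (at w)"
    using h C(1) by (auto simp: primitive_on_def)
  then have "((\<lambda>x. h x + (b w - h w)) has_derivative (\<odot>) (G w)) (at w)"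
    by (auto intro!: derivative_eq_intros)
  then have "(b has_derivative (\<odot>) (G w)) (at w)"
    by (rule has_derivative_transform_within_open[OF _ C'(1) C(1)]) (erule b[symmetric])
  then show ?thesis
    by (rule frechet_derivative_at[symmetric])
qed

lemma primitive_branch:
  assumes prim: "primitive_on C h" and "w0 \<in> C" "k \<in> H w0" "open N" "N \<subseteq> C"
  shows "branch_on H N (\<lambda>x. h x + (k - h w0))"
  unfolding branch_on_def
proof (intro conjI ballI)
  show "continuous_on N (\<lambda>x. h x + (k - h w0))"
    by (intro continuous_intros continuous_on_subset[OF primitive_continuous_on[OF prim]] assms)
  fix x assume "x \<in> N"
  then have "k + (h x - h w0) \<in> H x"
    using assms by (intro values_transport[OF prim]) auto
  then show "h x + (k - h w0) \<in> H x"
    by (simp add: algebra_simps)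
qed (fact assms)

lemma primitive_around:
  assumes "w \<in> R"
  obtains C h where "primitive_on C h" "w \<in> C"
proof -
  obtain r where "r > 0" "ball w r \<subseteq> R"
    using open_regular_domain assms open_contains_ball by blast
  then show thesis
    using primitive_exists[of "ball w r"] that by (metis centre_in_ball convex_ball open_ball)
qed

section \<open>Rectification and the pulled back metric\<close>

text \<open>
The branch through the value \<open>k\<close> is the primitive normalised to take this value at \<open>w0\<close>. It
sends \<open>F\<close> to \<open>e\<close> since its derivative is multiplication by the inverse of \<open>F\<close>.
\<close>

theorem rectification: "multivalued_rectification H R F e"
  unfolding multivalued_rectification_def
proof (intro ballI conjI)
  fix w0 assume "w0 \<in> R"
  then show "H w0 \<noteq> {}"
    by (rule values_nonempty)
  obtain C h where h: "primitive_on C h" "w0 \<in> C"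
    using primitive_around[OF \<open>w0 \<in> R\<close>] .
  have "C \<subseteq> R" using h(1) by (simp add: primitive_on_def)
  obtain N where N: "open N" "w0 \<in> N" "N \<subseteq> C"
    "\<And>c. diffeomorphism_between N ((\<lambda>x. h x + c) ` N) (\<lambda>x. h x + c)"
    using primitive_local_diffeomorphism[OF h] by metis
  have "\<exists>V b. open V \<and> k \<in> V \<and> diffeomorphism_between N V b \<and> branch_on H N b \<and> b w0 = k \<and>
      (\<forall>w\<in>N. frechet_derivative b (at w) (F w) = e)" if "k \<in> H w0" for k
  proof -
    let ?b = "\<lambda>x. h x + (k - h w0)"
    have diff: "diffeomorphism_between N (?b ` N) ?b"
      by (rule N)
    have branch: "branch_on H N ?b"
      using primitive_branch[OF h that N(1,3)] .
    have "frechet_derivative ?b (at w) (F w) = e" if "w \<in> N" for w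
    proof -
      have "w \<in> R" using that N(3) \<open>C \<subseteq> R\<close> by blast
      have "frechet_derivative ?b (at w) = (\<odot>) (G w)"
        using that N(3) \<open>C \<subseteq> R\<close> by (intro branch_derivative[OF branch]) auto
      then show ?thesis
        using mult_inverse[OF regular_domainD(2)[OF \<open>w \<in> R\<close>]] by (simp add: mult_commute)
    qed
    moreover have "open (?b ` N)"
      using diff by (simp add: diffeomorphism_between_def)
    moreover have "k \<in> ?b ` N"
      using N(2) by (intro image_eqI[of _ _ w0]) simp_all
    ultimately show ?thesis
      using diff branch by (intro exI[of _ "?b ` N"] exI[of _ ?b]) auto
  qed
  then show "\<exists>N. open N \<and> w0 \<in> N \<and> N \<subseteq> R \<and> (\<forall>k\<in>H w0. \<exists>V b. open V \<and> k \<in> V \<and>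
      diffeomorphism_between N V b \<and> branch_on H N b \<and> b w0 = k \<and>
      (\<forall>w\<in>N. frechet_derivative b (at w) (F w) = e))"
    using N(1-3) \<open>C \<subseteq> R\<close> by (intro exI[of _ N]) auto
qed

definition pullback_metric :: "real^3 \<Rightarrow> real^3 \<Rightarrow> real^3 \<Rightarrow> real" where
  "pullback_metric w u v = (G w \<odot> u) \<bullet> (G w \<odot> v)"

theorem pullback_metric_is_pullback: "is_multivalued_pullback H R natural_metric pullback_metric"
  unfolding is_multivalued_pullback_def
proof (intro ballI conjI allI impI)
  fix w assume "w \<in> R"
  obtain C h where h: "primitive_on C h" "w \<in> C"
    using primitive_around[OF \<open>w \<in> R\<close>] .
  obtain k where k: "k \<in> H w"
    using values_nonempty[OF \<open>w \<in> R\<close>] by blast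
  have C: "open C" "C \<subseteq> R" and deriv: "\<And>x. x \<in> C \<Longrightarrow> (h has_derivative (\<odot>) (G x)) (at x)"
    using h(1) by (auto simp: primitive_on_def)
  have "(\<lambda>x. h x + (k - h w)) differentiable_on C"
    using deriv unfolding differentiable_on_def
    by (intro ballI differentiable_add differentiable_const)
       (auto intro: differentiableI has_derivative_at_withinI)
  then show "\<exists>N b. w \<in> N \<and> N \<subseteq> R \<and> branch_on H N b \<and> b differentiable_on N"
    using h C k primitive_branch[OF h k C(1)]
    by (intro exI[of _ C] exI[of _ "\<lambda>x. h x + (k - h w)"]) auto
next
  fix w N b u v
  assume "w \<in> R" and "w \<in> N \<and> N \<subseteq> R \<and> branch_on H N b \<and> b differentiable_on N"
  then have "frechet_derivative b (at w) = (\<odot>) (G w)"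
    using branch_derivative by blast
  then show "pullback_metric w u v =
      natural_metric (b w) (frechet_derivative b (at w) u) (frechet_derivative b (at w) v)"
    by (simp add: pullback_metric_def natural_metric_def)
qed

text \<open>
Positivity holds since multiplication by the unit \<open>G w\<close> is injective. The coefficients inherit
differentiability from \<open>G\<close>, hence from \<open>F\<close>.
\<close>

theorem scaled_pullback_metric_riemannian:
  "riemannian_metric_on R (\<lambda>w u v. 1 / (norm e)\<^sup>2 * pullback_metric w u v)"
  unfolding riemannian_metric_on_def
proof (intro conjI ballI allI impI)
  fix w u v assume "w \<in> R"
  show "bilinear (\<lambda>u v. 1 / (norm e)\<^sup>2 * pullback_metric w u v)"
    unfolding bilinear_def linear_iff
    by (simp add: pullback_metric_def product.add_right product.scaleR_right inner_add_left
        inner_add_right algebra_simps add_divide_distrib)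
  show "1 / (norm e)\<^sup>2 * pullback_metric w u v = 1 / (norm e)\<^sup>2 * pullback_metric w v u"
    by (simp add: pullback_metric_def inner_commute)
next
  fix w u :: "real^3" assume "w \<in> R" "u \<noteq> 0"
  have "G w \<odot> u \<noteq> 0"
    using inverse_cancel(2)[OF regular_domainD(2)[OF \<open>w \<in> R\<close>], of u] \<open>u \<noteq> 0\<close>
    by (auto simp: product.zero_right)
  then show "0 < 1 / (norm e)\<^sup>2 * pullback_metric w u u"
    using unit_nonzero by (simp add: pullback_metric_def)
next
  fix u v
  show "(\<lambda>w. 1 / (norm e)\<^sup>2 * pullback_metric w u v) differentiable_on R"
    unfolding differentiable_on_def
  proof
    fix w assume "w \<in> R"
    then obtain q where q: "(G has_derivative (\<odot>) q) (at w within R)"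
      using reciprocal_has_derivative has_derivative_at_withinI by blast
    have "(\<lambda>w. G w \<odot> u) differentiable (at w within R)" for u
      using bounded_linear.has_derivative[OF product.bounded_linear_left q] differentiableI by blast
    then show "(\<lambda>w. 1 / (norm e)\<^sup>2 * pullback_metric w u v) differentiable (at w within R)"
      unfolding pullback_metric_def
      by (intro differentiable_mult differentiable_const differentiable_inner)
  qed
qed

end

theorem theorem3p1:
  fixes m :: "real^3 \<Rightarrow> real^3 \<Rightarrow> real^3" and e :: "real^3"
    and F :: "real^3 \<Rightarrow> real^3" and \<Omega> :: "(real^3) set"
    and base :: "(real^3) set \<Rightarrow> real^3"
  defines "R \<equiv> regular_domain m e F \<Omega>"
  defines "H \<equiv> multivalued_integral m e F R base"
  assumes "algebra_on_R3 m e"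
    and "open \<Omega>"
    and "algebrizable m F \<Omega>"
    and "\<forall>C\<in>components R. base C \<in> C"
  shows "multivalued_rectification H R F e \<and>
    (\<exists>g p. is_multivalued_pullback H R natural_metric p \<and>
       (\<forall>w\<in>R. \<forall>u v. g w u v = 1 / (norm e)\<^sup>2 * p w u v) \<and>
       riemannian_metric_on R g)"
proof -
  interpret algebrizable_field m e F \<Omega>
    using assms by (simp add: algebrizable_field_def algebrizable_field_axioms_def algebra_on_R3_iff)
  interpret based_algebrizable_field m e F \<Omega> base
    using assms by unfold_locales auto
  show ?thesis
    unfolding H_def R_def
    by (intro conjI rectification exI[of _ pullback_metric] pullback_metric_is_pullback
        exI[of _ "\<lambda>w u v. 1 / (norm e)\<^sup>2 * pullback_metric w u v"]
        scaled_pullback_metric_riemannian) simp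
qed

end
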